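(* Let $G$ be a Lie group with Lie algebra $\mathfrak g$, and let $H=H(g,\xi,\mu,\nu)$ be a smooth function on the symplectic manifold $({}^{1}T^*TG,\Omega_{{}^{1}T^*TG})$, where ${}^{1}T^*TG=(G\circledS\mathfrak g_1)\circledS(\mathfrak g_2^*\times\mathfrak g_3^* )$. The trivialized Hamilton's equations, i.e. the equations for integral curves of the vector field $X_H$ defined by $i_{X_H}\Omega_{{}^{1}T^*TG}=-dH$, are $$\frac{dg}{dt}=T_eR_g\frac{\delta H}{\delta\mu},\qquad \frac{d\xi}{dt}=\frac{\delta H}{\delta\nu}+ad_\xi\frac{\delta H}{\delta\mu},$$ $$\frac{d\mu}{dt}=-T_e^*R_g\frac{\delta H}{\delta g}-ad^*_\xi\frac{\delta H}{\delta\xi}+ad^*_{\frac{\delta H}{\delta\mu}}\mu+ad^*_{\frac{\delta H}{\delta\nu}}\nu,\qquad \frac{d\nu}{dt}=-\frac{\delta H}{\delta\xi}+ad^*_{\frac{\delta H}{\delta\mu}}\nu.$$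
   Context: Conventions. $G$ is a (finite-dimensional) Lie group with identity $e$, $\mathfrak g=T_eG$, $\mathfrak g^*$ its dual, $\mathfrak g^{**}=\mathfrak g$. $R_g$ is right translation and $T_e^*R_g:T_g^*G\to\mathfrak g^*$ is the dual of $T_eR_g$. $Ad_g$ is the tangent map at $e$ of $h\mapsto g^{-1}hg$; the Lie bracket is $[\xi,\eta]=ad_\xi\eta=\frac{d}{dt}|_{t=0}Ad_{\exp(t\xi)}\eta$ (the bracket of right invariant vector fields). $ad^*_\xi$ is defined by $\langle ad^*_\xi\mu,\eta\rangle=\langle\mu,[\xi,\eta]\rangle$. Partial derivatives: $\delta H/\delta g\in T_g^*G$, $\delta H/\delta\xi\in\mathfrak g^*$, $\delta H/\delta\mu,\delta H/\delta\nu\in\mathfrak g$. As a manifold ${}^{1}T^*TG=G\times\mathfrak g\times\mathfrak g^*\times\mathfrak g^*\ni(g,\xi,\mu,\nu)$ (subscripts on copies of $\mathfrak g,\mathfrak g^*$ are only labels). It is the right trivialization of $T^*(G\circledS\mathfrak g)$. For $(\eta,\zeta,\lambda_1,\lambda_2)\in\mathfrak g\times\mathfrak g\times\mathfrak g^*\times\mathfrak g^*$ define the (right invariant) vector field $$X_{(\eta,\zeta,\lambda_1,\lambda_2)}(g,\xi,\mu,\nu)=(T_eR_g\eta,\ \zeta+[\xi,\eta],\ \lambda_1+ad^*_\eta\mu+ad^*_\zeta\nu,\ \lambda_2+ad^*_\eta\nu).$$ These span all tangent spaces, and the symplectic form is determined by $$\Omega_{{}^{1}T^*TG}(X_{(\eta,\zeta,\lambda_1,\lambda_2)},X_{(\bar\eta,\bar\zeta,\bar\lambda_1,\bar\lambda_2)})=\langle\lambda_1,\bar\eta\rangle+\langle\lambda_2,\bar\zeta\rangle-\langle\bar\lambda_1,\eta\rangle-\langle\bar\lambda_2,\zeta\rangle+\langle\mu,[\eta,\bar\eta]\rangle+\langle\nu,[\eta,\bar\zeta]-[\bar\eta,\zeta]\rangle.$$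 *)

theory Defs
  imports "HOL-Analysis.Analysis" "HOL-Algebra.Group"
begin

section \<open>Smooth maps between normed spaces\<close>

text \<open>
  Iterated directional derivatives; on a finite-dimensional domain this is the usual notion
  of a \<open>C\<^sup>n\<close> map on an open set.
\<close>

primrec Ck_on :: "nat \<Rightarrow> 'a::real_normed_vector set \<Rightarrow> ('a \<Rightarrow> 'b::real_normed_vector) \<Rightarrow> bool" where
  "Ck_on 0 S f \<longleftrightarrow> continuous_on S f"
| "Ck_on (Suc n) S f \<longleftrightarrow>
     (\<forall>x\<in>S. f differentiable (at x)) \<and> (\<forall>v. Ck_on n S (\<lambda>x. frechet_derivative f (at x) v))"

definition smooth_on :: "'a::real_normed_vector set \<Rightarrow> ('a \<Rightarrow> 'b::real_normed_vector) \<Rightarrow> bool" where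
  "smooth_on S f \<longleftrightarrow> (\<forall>n. Ck_on n S f)"

section \<open>Manifolds\<close>

text \<open>
  An atlas is given as a family of charts \<open>(U, \<phi>)\<close> indexed by the points of the manifold, the
  chart with index \<open>p\<close> being defined at \<open>p\<close>. The smooth structure depends only on the range of
  the family, and every smooth structure arises in this way. The indexing serves to fix
  coordinates on tangent spaces: a tangent vector at \<open>p\<close> is represented by its coordinate vector
  in the chart with index \<open>p\<close>, so that every tangent space is the model space \<open>'a\<close> itself.
  The model space is an arbitrary finite-dimensional normed space (rather than a type of class
  \<open>euclidean_space\<close>), so that dimension 0 is included.
\<close>

type_synonym ('m, 'a) atlas = "'m \<Rightarrow> 'm set \<times> ('m \<Rightarrow> 'a)"

definition chart_dom :: "('m, 'a) atlas \<Rightarrow> 'm \<Rightarrow> 'm set" where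
  "chart_dom C p = fst (C p)"

definition chart :: "('m, 'a) atlas \<Rightarrow> 'm \<Rightarrow> 'm \<Rightarrow> 'a" where
  "chart C p = snd (C p)"

definition chart_inv :: "('m, 'a) atlas \<Rightarrow> 'm \<Rightarrow> 'a \<Rightarrow> 'm" where
  "chart_inv C p = inv_into (chart_dom C p) (chart C p)"

definition smooth_manifold ::
    "('m::{t2_space, second_countable_topology}, 'a::real_normed_vector) atlas \<Rightarrow> bool" where
  "smooth_manifold C \<longleftrightarrow>
     (\<exists>B :: 'a set. finite B \<and> span B = UNIV) \<and>
     (\<forall>p. p \<in> chart_dom C p \<and> open (chart_dom C p) \<and> open (chart C p ` chart_dom C p) \<and>
          homeomorphism (chart_dom C p) (chart C p ` chart_dom C p) (chart C p) (chart_inv C p)) \<and>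
     (\<forall>p q. smooth_on (chart C p ` (chart_dom C p \<inter> chart_dom C q)) (chart C q \<circ> chart_inv C p))"

definition vector_atlas :: "('a, 'a) atlas" where
  "vector_atlas = (\<lambda>_. (UNIV, id))"

definition prod_atlas :: "('m, 'a) atlas \<Rightarrow> ('n, 'b) atlas \<Rightarrow> ('m \<times> 'n, 'a \<times> 'b) atlas" where
  "prod_atlas C D =
     (\<lambda>(p, q). (chart_dom C p \<times> chart_dom D q, map_prod (chart C p) (chart D q)))"

definition smooth_map ::
    "('m::topological_space, 'a::real_normed_vector) atlas \<Rightarrow>
     ('n::topological_space, 'b::real_normed_vector) atlas \<Rightarrow> ('m \<Rightarrow> 'n) \<Rightarrow> bool" where
  "smooth_map C D f \<longleftrightarrow>
     continuous_on UNIV f \<and>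
     (\<forall>p q. smooth_on (chart C p ` (chart_dom C p \<inter> f -` chart_dom D q))
                      (chart D q \<circ> f \<circ> chart_inv C p))"

definition tangent_map ::
    "('m, 'a::real_normed_vector) atlas \<Rightarrow> ('n, 'b::real_normed_vector) atlas \<Rightarrow>
     ('m \<Rightarrow> 'n) \<Rightarrow> 'm \<Rightarrow> 'a \<Rightarrow> 'b" where
  "tangent_map C D f p =
     frechet_derivative (chart D (f p) \<circ> f \<circ> chart_inv C p) (at (chart C p p))"

definition has_velocity ::
    "('m::topological_space, 'a::real_normed_vector) atlas \<Rightarrow> (real \<Rightarrow> 'm) \<Rightarrow> 'a \<Rightarrow> real \<Rightarrow> bool" where
  "has_velocity C c v t \<longleftrightarrow>
     isCont c t \<and> ((\<lambda>s. chart C (c t) (c s)) has_vector_derivative v) (at t)"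

definition integral_curve ::
    "('m::topological_space, 'a::real_normed_vector) atlas \<Rightarrow> ('m \<Rightarrow> 'a) \<Rightarrow> real set \<Rightarrow>
     (real \<Rightarrow> 'm) \<Rightarrow> bool" where
  "integral_curve C X I c \<longleftrightarrow> (\<forall>t\<in>I. has_velocity C c (X (c t)) t)"

section \<open>Lie groups\<close>

definition lie_group ::
    "'g::{t2_space, second_countable_topology} monoid \<Rightarrow> ('g, 'a::real_normed_vector) atlas \<Rightarrow> bool"
  where
  "lie_group G C \<longleftrightarrow>
     group G \<and> carrier G = UNIV \<and> smooth_manifold C \<and>
     smooth_map (prod_atlas C C) C (\<lambda>(x, y). x \<otimes>\<^bsub>G\<^esub> y) \<and>
     smooth_map C C (\<lambda>x. inv\<^bsub>G\<^esub> x)"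

text \<open>The Lie algebra, i.e. the tangent space at \<open>\<one>\<close>, is the type \<open>'a\<close>; its dual is \<open>'a dual\<close>.\<close>

type_synonym 'a dual = "'a \<Rightarrow>\<^sub>L real"

definition right_translation :: "'g monoid \<Rightarrow> 'g \<Rightarrow> 'g \<Rightarrow> 'g" where
  "right_translation G g = (\<lambda>h. h \<otimes>\<^bsub>G\<^esub> g)"

definition TR :: "'g monoid \<Rightarrow> ('g, 'a::real_normed_vector) atlas \<Rightarrow> 'g \<Rightarrow> 'a \<Rightarrow> 'a" where
  "TR G C g = tangent_map C C (right_translation G g) \<one>\<^bsub>G\<^esub>"

definition TR_dual ::
    "'g monoid \<Rightarrow> ('g, 'a::real_normed_vector) atlas \<Rightarrow> 'g \<Rightarrow> 'a dual \<Rightarrow> 'a dual" where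
  "TR_dual G C g \<alpha> = Blinfun (\<lambda>\<eta>. blinfun_apply \<alpha> (TR G C g \<eta>))"

definition Ad :: "'g monoid \<Rightarrow> ('g, 'a::real_normed_vector) atlas \<Rightarrow> 'g \<Rightarrow> 'a \<Rightarrow> 'a" where
  "Ad G C g = tangent_map C C (\<lambda>h. inv\<^bsub>G\<^esub> g \<otimes>\<^bsub>G\<^esub> h \<otimes>\<^bsub>G\<^esub> g) \<one>\<^bsub>G\<^esub>"

definition one_parameter_subgroup ::
    "'g::topological_space monoid \<Rightarrow> ('g, 'a::real_normed_vector) atlas \<Rightarrow> 'a \<Rightarrow> (real \<Rightarrow> 'g) \<Rightarrow> bool"
  where
  "one_parameter_subgroup G C \<xi> c \<longleftrightarrow>
     smooth_map vector_atlas C c \<and> (\<forall>s t. c (s + t) = c s \<otimes>\<^bsub>G\<^esub> c t) \<and> has_velocity C c \<xi> 0"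

definition lie_exp ::
    "'g::topological_space monoid \<Rightarrow> ('g, 'a::real_normed_vector) atlas \<Rightarrow> 'a \<Rightarrow> 'g" where
  "lie_exp G C \<xi> = (THE c. one_parameter_subgroup G C \<xi> c) 1"

text \<open>
  The Lie bracket \<open>[\<xi>, \<eta>]\<close>. Since \<open>Ad\<close> is built from \<open>h \<mapsto> g\<inverse> h g\<close>, this is the bracket of right
  invariant vector fields, the negative of the more common left invariant convention.
\<close>

definition ad ::
    "'g::topological_space monoid \<Rightarrow> ('g, 'a::real_normed_vector) atlas \<Rightarrow> 'a \<Rightarrow> 'a \<Rightarrow> 'a" where
  "ad G C \<xi> \<eta> = vector_derivative (\<lambda>t. Ad G C (lie_exp G C (t *\<^sub>R \<xi>)) \<eta>) (at 0)"

definition ad_dual ::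
    "'g::topological_space monoid \<Rightarrow> ('g, 'a::real_normed_vector) atlas \<Rightarrow> 'a \<Rightarrow> 'a dual \<Rightarrow> 'a dual"
  where
  "ad_dual G C \<xi> \<mu> = Blinfun (\<lambda>\<eta>. blinfun_apply \<mu> (ad G C \<xi> \<eta>))"

section \<open>The trivialized phase space\<close>

type_synonym ('g, 'a) phase = "'g \<times> 'a \<times> 'a dual \<times> 'a dual"

type_synonym 'a phase_tangent = "'a \<times> 'a \<times> 'a dual \<times> 'a dual"

definition phase_atlas ::
    "('g, 'a::real_normed_vector) atlas \<Rightarrow> (('g, 'a) phase, 'a phase_tangent) atlas" where
  "phase_atlas C = prod_atlas C (prod_atlas vector_atlas (prod_atlas vector_atlas vector_atlas))"

fun inv_field ::
    "'g::topological_space monoid \<Rightarrow> ('g, 'a::real_normed_vector) atlas \<Rightarrow>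
     'a \<times> 'a \<times> 'a dual \<times> 'a dual \<Rightarrow> ('g, 'a) phase \<Rightarrow> 'a phase_tangent" where
  "inv_field G C (\<eta>, \<zeta>, \<alpha>, \<beta>) (g, \<xi>, \<mu>, \<nu>) =
     (TR G C g \<eta>,
      \<zeta> + ad G C \<xi> \<eta>,
      \<alpha> + ad_dual G C \<eta> \<mu> + ad_dual G C \<zeta> \<nu>,
      \<beta> + ad_dual G C \<eta> \<nu>)"

fun Omega_inv ::
    "'g::topological_space monoid \<Rightarrow> ('g, 'a::real_normed_vector) atlas \<Rightarrow> ('g, 'a) phase \<Rightarrow>
     'a \<times> 'a \<times> 'a dual \<times> 'a dual \<Rightarrow> 'a \<times> 'a \<times> 'a dual \<times> 'a dual \<Rightarrow> real" where
  "Omega_inv G C (g, \<xi>, \<mu>, \<nu>) (\<eta>, \<zeta>, \<alpha>, \<beta>) (\<eta>', \<zeta>', \<alpha>', \<beta>') =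
     blinfun_apply \<alpha> \<eta>' + blinfun_apply \<beta> \<zeta>' - blinfun_apply \<alpha>' \<eta> - blinfun_apply \<beta>' \<zeta>
     + blinfun_apply \<mu> (ad G C \<eta> \<eta>')
     + blinfun_apply \<nu> (ad G C \<eta> \<zeta>' - ad G C \<eta>' \<zeta>)"

text \<open>
  The symplectic form, determined by its values on the right invariant vector fields: at each
  point these exhaust the tangent space.
\<close>

definition Omega ::
    "'g::topological_space monoid \<Rightarrow> ('g, 'a::real_normed_vector) atlas \<Rightarrow> ('g, 'a) phase \<Rightarrow>
     'a phase_tangent \<Rightarrow> 'a phase_tangent \<Rightarrow> real" where
  "Omega G C p =
     (THE \<omega>. \<forall>a b. \<omega> (inv_field G C a p) (inv_field G C b p) = Omega_inv G C p a b)"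

definition differential ::
    "('g, 'a::real_normed_vector) atlas \<Rightarrow> (('g, 'a) phase \<Rightarrow> real) \<Rightarrow> ('g, 'a) phase \<Rightarrow>
     'a phase_tangent \<Rightarrow> real" where
  "differential C H p = tangent_map (phase_atlas C) vector_atlas H p"

text \<open>The vector field \<open>X\<^sub>H\<close> with \<open>i\<^bsub>X\<^sub>H\<^esub> \<Omega> = - dH\<close>.\<close>

definition hamiltonian_field ::
    "'g::topological_space monoid \<Rightarrow> ('g, 'a::real_normed_vector) atlas \<Rightarrow>
     (('g, 'a) phase \<Rightarrow> real) \<Rightarrow> ('g, 'a) phase \<Rightarrow> 'a phase_tangent" where
  "hamiltonian_field G C H p = (THE v. \<forall>w. Omega G C p v w = - differential C H p w)"

section \<open>Partial derivatives\<close>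

fun delta_g ::
    "('g, 'a::real_normed_vector) atlas \<Rightarrow> (('g, 'a) phase \<Rightarrow> real) \<Rightarrow> ('g, 'a) phase \<Rightarrow> 'a dual" where
  "delta_g C H (g, \<xi>, \<mu>, \<nu>) = Blinfun (tangent_map C vector_atlas (\<lambda>h. H (h, \<xi>, \<mu>, \<nu>)) g)"

fun delta_xi :: "(('g, 'a::real_normed_vector) phase \<Rightarrow> real) \<Rightarrow> ('g, 'a) phase \<Rightarrow> 'a dual" where
  "delta_xi H (g, \<xi>, \<mu>, \<nu>) = Blinfun (frechet_derivative (\<lambda>x. H (g, x, \<mu>, \<nu>)) (at \<xi>))"

text \<open>The double dual of the Lie algebra is identified with the Lie algebra by evaluation.\<close>

fun delta_mu :: "(('g, 'a::real_normed_vector) phase \<Rightarrow> real) \<Rightarrow> ('g, 'a) phase \<Rightarrow> 'a" where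
  "delta_mu H (g, \<xi>, \<mu>, \<nu>) =
     (THE \<eta>. \<forall>\<alpha>. frechet_derivative (\<lambda>x. H (g, \<xi>, x, \<nu>)) (at \<mu>) \<alpha> = blinfun_apply \<alpha> \<eta>)"

fun delta_nu :: "(('g, 'a::real_normed_vector) phase \<Rightarrow> real) \<Rightarrow> ('g, 'a) phase \<Rightarrow> 'a" where
  "delta_nu H (g, \<xi>, \<mu>, \<nu>) =
     (THE \<zeta>. \<forall>\<alpha>. frechet_derivative (\<lambda>x. H (g, \<xi>, \<mu>, x)) (at \<nu>) \<alpha> = blinfun_apply \<alpha> \<zeta>)"

end

(*
  Only two properties of the bracket enter: ad is linear in its second argument and antisymmetric.
  Granted these, the right invariant frame identifies each tangent space with
  g x g x g* x g*, Omega is nondegenerate in this frame, and comparing the coefficients of the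
  four components of a test vector in i_X Omega = - dH determines the frame components of X_H:
  (dH/dmu, dH/dnu, - T*R dH/dg - ad*_xi dH/dxi, - dH/dxi).

  The bracket is defined through the exponential map, so one-parameter subgroups have to be
  constructed first. In the chart at the identity a local one is a solution (by Picard iteration)
  of the equation of a right invariant vector field. If a and b are curves with a'(t) = xi a(t)
  and b'(t) = xi b(t), then a(t)^-1 b(t) has zero velocity and is constant; this gives both the
  local homomorphism property and uniqueness, and c(t) = c(t/n)^n extends to all t.
  The chain rule now makes ad bilinear, and ad_xi xi = 0 because a one-parameter
  subgroup commutes with itself.
*)

theory Submission
  imports Defs
begin

section \<open>Coordinates in finite dimension\<close>

text \<open>The model space is only a normed space with a finite spanning set, so calculus on it
  rests on bounded coordinate functionals: expanding vectors in them gives the chain rule for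
  \<open>Ck_on\<close>, operator norm bounds and the identification of the double dual. Tangent
  vectors are coordinate vectors in the chart of their own base point, so velocities of one curve at
  different times refer to different charts. Two devices cope with this:
  \<open>chart_velocity\<close> keeps a chart fixed, and \<open>log_velocity\<close> translates
  velocities back to the identity. Identities between tangent maps are obtained by letting them act
  on curves and using that a velocity is unique. The definition of \<open>ad\<close> through
  \<open>lie_exp\<close> says nothing about sums in the first argument; additivity there comes from
  writing the bracket as a mixed second derivative of conjugation in one chart.
  \<open>lie_exp\<close>, \<open>Omega\<close>, \<open>hamiltonian_field\<close>,
  \<open>delta_mu\<close> and \<open>delta_nu\<close> are definite descriptions, so each has to be
  resolved by existence and uniqueness before it can be computed with.\<close>

lemma independent_coefficients_bounded:
  fixes B :: "'a::real_normed_vector set"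
  assumes "finite B" "independent B"
  shows "\<exists>K\<ge>0. \<forall>a. \<forall>b\<in>B. \<bar>a b\<bar> \<le> K * norm (\<Sum>b\<in>B. a b *\<^sub>R b)"
  using assms
proof (induction B rule: finite_induct)
  case empty
  then show ?case by (intro exI[of _ 0]) simp
next
  case (insert b B)
  then have indep: "independent B" and nb: "b \<notin> span B"
    by (auto simp: independent_insert split: if_splits)
  then obtain K where K: "K \<ge> 0" "\<And>a c. c \<in> B \<Longrightarrow> \<bar>a c\<bar> \<le> K * norm (\<Sum>b\<in>B. a b *\<^sub>R b)"
    using insert.IH by blast
  \<comment> \<open>The distance is positive because the span is closed: along a convergent sequence
    in it the coefficients are Cauchy by the induction hypothesis, so the limit is again a
    combination of B.\<close>
  have "\<exists>d>0. \<forall>v\<in>span B. d \<le> norm (b - v)"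
  proof (rule ccontr)
    assume "\<not> (\<exists>d>0. \<forall>v\<in>span B. d \<le> norm (b - v))"
    then have "\<exists>v\<in>span B. norm (b - v) < inverse (real (Suc n))" for n
      by (metis inverse_positive_iff_positive not_le of_nat_0_less_iff zero_less_Suc)
    then obtain v where v: "\<And>n. v n \<in> span B" "\<And>n. norm (b - v n) < inverse (real (Suc n))"
      by metis
    have "(\<lambda>n. norm (b - v n)) \<longlonglongrightarrow> 0"
      by (rule tendsto_sandwich[OF _ _ tendsto_const LIMSEQ_inverse_real_of_nat])
         (use v(2) in \<open>auto intro!: always_eventually less_imp_le\<close>)
    then have "(\<lambda>n. b - v n) \<longlonglongrightarrow> 0"
      using tendsto_norm_zero_iff by blast
    from tendsto_diff[OF tendsto_const[of b] this] have lim: "v \<longlonglongrightarrow> b"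
      by simp
    have "\<exists>a. v n = (\<Sum>c\<in>B. a c *\<^sub>R c)" for n
      using v(1)[of n] span_finite[OF insert.hyps(1)] by auto
    then obtain a where a: "\<And>n. v n = (\<Sum>c\<in>B. a n c *\<^sub>R c)"
      by metis
    have "convergent (\<lambda>n. a n c)" if c: "c \<in> B" for c
    proof -
      have le: "\<bar>a n c - a m c\<bar> \<le> K * norm (v n - v m)" for n m
        using K(2)[OF c, of "\<lambda>c. a n c - a m c"]
        by (simp add: a scaleR_left_diff_distrib sum_subtractf)
      have "Cauchy v"
        using lim LIMSEQ_imp_Cauchy by blast
      have "Cauchy (\<lambda>n. a n c)"
      proof (rule metric_CauchyI)
        fix e :: real assume "e > 0"
        then have "e / (K + 1) > 0" using K(1) by simp
        then obtain M where M: "\<And>m n. m \<ge> M \<Longrightarrow> n \<ge> M \<Longrightarrow> dist (v m) (v n) < e / (K + 1)"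
          using metric_CauchyD[OF \<open>Cauchy v\<close>] by metis
        have "dist (a m c) (a n c) < e" if "m \<ge> M" "n \<ge> M" for m n
        proof -
          have "dist (a m c) (a n c) \<le> K * dist (v m) (v n)"
            using le by (simp add: dist_norm)
          also have "\<dots> \<le> (K + 1) * dist (v m) (v n)"
            by (intro mult_right_mono) auto
          also have "\<dots> < e"
            using M[OF that] K(1) by (simp add: field_simps)
          finally show ?thesis .
        qed
        then show "\<exists>M. \<forall>m\<ge>M. \<forall>n\<ge>M. dist (a m c) (a n c) < e" by blast
      qed
      then show ?thesis using Cauchy_convergent_iff by blast
    qed
    then obtain A where "\<And>c. c \<in> B \<Longrightarrow> (\<lambda>n. a n c) \<longlonglongrightarrow> A c"
      unfolding convergent_def by metis
    then have "(\<lambda>n. \<Sum>c\<in>B. a n c *\<^sub>R c) \<longlonglongrightarrow> (\<Sum>c\<in>B. A c *\<^sub>R c)"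
      by (intro tendsto_intros)
    then have "b = (\<Sum>c\<in>B. A c *\<^sub>R c)"
      using lim LIMSEQ_unique a by (metis (no_types, lifting) ext)
    then have "b \<in> span B"
      by (metis (no_types, lifting) span_base span_scale span_sum)
    with nb show False by blast
  qed
  then obtain d where d: "d > 0" "\<And>v. v \<in> span B \<Longrightarrow> d \<le> norm (b - v)"
    by blast
  have bd: "\<bar>a b\<bar> \<le> inverse d * norm (\<Sum>b\<in>insert b B. a b *\<^sub>R b)" for a
  proof (cases "a b = 0")
    case False
    \<comment> \<open>The whole sum is \<open>a b\<close> times b minus this vector of the span, so
      the distance d bounds the coefficient of b.\<close>
    let ?v = "- (\<Sum>c\<in>B. (a c / a b) *\<^sub>R c)"
    have "?v \<in> span B"
      by (intro span_neg span_sum span_scale span_base)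
    then have "d \<le> norm (b - ?v)" by (rule d)
    then have "\<bar>a b\<bar> * d \<le> norm (a b *\<^sub>R (b - ?v))"
      by (simp add: mult_left_mono)
    also have "a b *\<^sub>R (b - ?v) = (\<Sum>b\<in>insert b B. a b *\<^sub>R b)"
      using insert.hyps False by (simp add: scaleR_right_distrib scaleR_sum_right)
    finally show ?thesis using d(1) by (simp add: field_simps)
  qed (use d in simp)
  \<comment> \<open>The first summand serves the coefficient of b. The second serves the others:
    their partial sum differs from the full sum by a multiple of b whose norm is at most
    \<open>inverse d * norm b\<close> times that of the full sum.\<close>
  define L where "L = inverse d + K * (1 + inverse d * norm b)"
  have L: "L \<ge> inverse d" "L \<ge> K * (1 + inverse d * norm b)" "L \<ge> 0"
    using d K(1) by (auto simp: L_def)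
  have "\<bar>a c\<bar> \<le> L * norm (\<Sum>b\<in>insert b B. a b *\<^sub>R b)" if "c \<in> insert b B" for a c
  proof (cases "c = b")
    case True
    have "inverse d * norm (\<Sum>b\<in>insert b B. a b *\<^sub>R b) \<le> L * norm (\<Sum>b\<in>insert b B. a b *\<^sub>R b)"
      using L(1) by (rule mult_right_mono) simp
    then show ?thesis using True bd[of a] by simp
  next
    case False
    let ?s = "\<Sum>b\<in>insert b B. a b *\<^sub>R b"
    have "(\<Sum>b\<in>B. a b *\<^sub>R b) = ?s - a b *\<^sub>R b"
      using insert.hyps by simp
    then have "norm (\<Sum>b\<in>B. a b *\<^sub>R b) \<le> norm ?s + \<bar>a b\<bar> * norm b"
      by (metis norm_scaleR norm_triangle_ineq4)
    also have "\<dots> \<le> norm ?s + (inverse d * norm ?s) * norm b"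
      using bd[of a] by (intro add_left_mono mult_right_mono) auto
    finally have *: "norm (\<Sum>b\<in>B. a b *\<^sub>R b) \<le> (1 + inverse d * norm b) * norm ?s"
      by (simp add: algebra_simps)
    have "\<bar>a c\<bar> \<le> K * norm (\<Sum>b\<in>B. a b *\<^sub>R b)"
      using K(2) that False by auto
    also have "\<dots> \<le> K * ((1 + inverse d * norm b) * norm ?s)"
      by (rule mult_left_mono[OF * K(1)])
    also have "\<dots> \<le> L * norm ?s"
      using L(2) by (metis mult.assoc mult_right_mono norm_ge_zero)
    finally show ?thesis .
  qed
  with L(3) show ?case by blast
qed

definition finite_dim :: "'a::real_normed_vector itself \<Rightarrow> bool" where
  "finite_dim _ \<longleftrightarrow> (\<exists>B :: 'a set. finite B \<and> span B = UNIV)"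

lemma finite_dim_coordinates:
  assumes "finite_dim TYPE('a::real_normed_vector)"
  obtains B :: "'a::real_normed_vector set" and \<phi> where
    "finite B" "\<And>b. bounded_linear (\<phi> b)" "\<And>x. x = (\<Sum>b\<in>B. \<phi> b x *\<^sub>R b)"
proof -
  obtain B0 :: "'a set" where B0: "finite B0" "span B0 = UNIV"
    using assms unfolding finite_dim_def by blast
  obtain B where B: "B \<subseteq> B0" "independent B" "B0 \<subseteq> span B"
    by (rule maximal_independent_subset)
  have fin: "finite B" using B(1) B0(1) finite_subset by blast
  have sp: "span B = UNIV"
    using span_mono[OF B(3)] B0(2) by (metis span_span top.extremum_uniqueI)
  define \<phi> where "\<phi> = (\<lambda>b x. representation B x b)"
  have lin: "\<phi> b (x + y) = \<phi> b x + \<phi> b y" "\<phi> b (r *\<^sub>R x) = r * \<phi> b x" for b x y r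
    using representation_add[OF B(2)] representation_scale[OF B(2)] sp
    by (auto simp: \<phi>_def)
  have ex: "(\<Sum>b\<in>B. \<phi> b x *\<^sub>R b) = x" for x
    unfolding \<phi>_def using sum_representation_eq[OF B(2) _ fin subset_refl] sp by simp
  obtain K where K: "K \<ge> 0" "\<And>a c. c \<in> B \<Longrightarrow> \<bar>a c\<bar> \<le> K * norm (\<Sum>b\<in>B. a b *\<^sub>R b)"
    using independent_coefficients_bounded[OF fin B(2)] by blast
  have "bounded_linear (\<phi> b)" for b
  proof (rule bounded_linear_intro)
    show "norm (\<phi> b x) \<le> norm x * K" for x
    proof (cases "b \<in> B")
      case True
      then show ?thesis using K(2)[OF True, of "\<lambda>c. \<phi> c x"] ex by (simp add: mult.commute)
    next
      \<comment> \<open>\<open>representation\<close> vanishes off B, so \<phi> b is bounded for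
        every b and later uses carry no membership condition.\<close>
      case False
      then have "\<phi> b x = 0"
        using representation_ne_zero[of B x b] by (auto simp: \<phi>_def)
      then show ?thesis using K(1) by simp
    qed
  qed (auto simp: lin)
  with fin ex that show ?thesis by metis
qed

lemma finite_dim_prod:
  assumes "finite_dim TYPE('a::real_normed_vector)" "finite_dim TYPE('b::real_normed_vector)"
  shows "finite_dim TYPE('a::real_normed_vector \<times> 'b::real_normed_vector)"
proof -
  obtain A :: "'a set" where A: "finite A" "span A = UNIV"
    using assms(1) unfolding finite_dim_def by blast
  obtain B :: "'b set" where B: "finite B" "span B = UNIV"
    using assms(2) unfolding finite_dim_def by blast
  let ?S = "(\<lambda>a. (a, 0)) ` A \<union> (\<lambda>b. (0, b)) ` B"
  have lin: "linear (\<lambda>a::'a. (a, 0::'b))" "linear (\<lambda>b::'b. (0::'a, b))"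
    by (auto intro!: linearI)
  have "(x, y) \<in> span ?S" for x y
  proof -
    have "(x, 0) \<in> span ?S"
      using span_mono[of "(\<lambda>a. (a, 0)) ` A" ?S] linear_span_image[OF lin(1), of A] A(2) by auto
    moreover have "(0, y) \<in> span ?S"
      using span_mono[of "(\<lambda>b. (0, b)) ` B" ?S] linear_span_image[OF lin(2), of B] B(2) by auto
    ultimately have "(x, 0) + (0, y) \<in> span ?S" by (rule span_add)
    then show ?thesis by simp
  qed
  then have "span ?S = UNIV" by auto
  moreover have "finite ?S" using A(1) B(1) by simp
  ultimately show ?thesis unfolding finite_dim_def by blast
qed

lemma finite_dim_real: "finite_dim TYPE(real)"
proof -
  have "x \<in> span {1}" for x :: real
    using span_scale[OF span_base, of "1::real" "{1}" x] by simp
  then show ?thesis unfolding finite_dim_def by (intro exI[of _ "{1}"]) auto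
qed

text \<open>A linear map is a finite sum of fixed vectors weighted by bounded coordinates. Applied
  to the bracket, this makes \<open>Blinfun\<close> in \<open>ad_dual\<close> meaningful.\<close>

lemma finite_dim_bounded_linear:
  fixes f :: "'a::real_normed_vector \<Rightarrow> 'b::real_normed_vector"
  assumes "finite_dim TYPE('a)" "linear f"
  shows "bounded_linear f"
proof -
  obtain B :: "'a set" and \<phi> where B: "finite B" "\<And>b. bounded_linear (\<phi> b)"
    and ex: "\<And>x. x = (\<Sum>b\<in>B. \<phi> b x *\<^sub>R b)"
    using finite_dim_coordinates[OF assms(1)] by blast
  have "f x = (\<Sum>b\<in>B. \<phi> b x *\<^sub>R f b)" for x
    using arg_cong[OF ex, of f x] by (simp add: linear_sum[OF assms(2)] linear_scale[OF assms(2)])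
  then have "f = (\<lambda>x. \<Sum>b\<in>B. \<phi> b x *\<^sub>R f b)" by blast
  moreover have "bounded_linear (\<lambda>x. \<Sum>b\<in>B. \<phi> b x *\<^sub>R f b)"
    by (intro bounded_linear_sum bounded_linear_scaleR_const B(2))
  ultimately show ?thesis by simp
qed

section \<open>Calculus of smooth maps\<close>

text \<open>A derivative at a point of an open set sees only nearby values, hence values in S; so
  pointwise equality carries over to every order.\<close>

lemma Ck_on_cong:
  assumes "open S" "\<And>x. x \<in> S \<Longrightarrow> f x = g x"
  shows "Ck_on n S f \<longleftrightarrow> Ck_on n S g"
  using assms(2)
proof (induction n arbitrary: f g)
  case 0
  then show ?case by (simp cong: continuous_on_cong)
next
  case (Suc n)
  have diff: "f differentiable (at x) \<longleftrightarrow> g differentiable (at x)" if "x \<in> S" for x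
    using has_derivative_transform_within_open[OF _ assms(1) that, of f _ UNIV g]
      has_derivative_transform_within_open[OF _ assms(1) that, of g _ UNIV f] Suc.prems
    by (auto simp: differentiable_def)
  have "frechet_derivative f (at x) v = frechet_derivative g (at x) v" if "x \<in> S" for x v
  proof -
    have "(f has_derivative D) (at x) \<longleftrightarrow> (g has_derivative D) (at x)" for D
      using has_derivative_transform_within_open[OF _ assms(1) that, of f D UNIV g]
        has_derivative_transform_within_open[OF _ assms(1) that, of g D UNIV f] Suc.prems
      by auto
    then show ?thesis by (simp add: frechet_derivative_def)
  qed
  with diff Suc.IH show ?case by (metis (no_types, lifting) Ck_on.simps(2))
qed

lemma Ck_on_transform:
  "open S \<Longrightarrow> Ck_on n S f \<Longrightarrow> (\<And>x. x \<in> S \<Longrightarrow> f x = g x) \<Longrightarrow> Ck_on n S g"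
  using Ck_on_cong by metis

lemma Ck_on_subset: "Ck_on n S f \<Longrightarrow> T \<subseteq> S \<Longrightarrow> Ck_on n T f"
proof (induction n arbitrary: f)
  case 0 then show ?case by (auto intro: continuous_on_subset)
qed auto

lemma Ck_on_local:
  assumes "\<And>x. x \<in> S \<Longrightarrow> \<exists>T. open T \<and> x \<in> T \<and> Ck_on n T f"
  shows "Ck_on n S f"
  using assms
proof (induction n arbitrary: f)
  case 0
  then have "isCont f x" if "x \<in> S" for x
    using that by (metis Ck_on.simps(1) continuous_on_eq_continuous_at)
  then show ?case by (simp add: continuous_at_imp_continuous_on)
next
  case (Suc n)
  have "Ck_on n S (\<lambda>x. frechet_derivative f (at x) v)" for v
    by (rule Suc.IH) (use Suc.prems in fastforce)
  moreover have "f differentiable (at x)" if "x \<in> S" for x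
    using Suc.prems[OF that] by auto
  ultimately show ?case by simp
qed

lemma Ck_on_SucI:
  assumes "open S" "\<And>x. x \<in> S \<Longrightarrow> (f has_derivative f' x) (at x)"
    and "\<And>v. Ck_on n S (\<lambda>x. f' x v)"
  shows "Ck_on (Suc n) S f"
proof -
  have "frechet_derivative f (at x) v = f' x v" if "x \<in> S" for x v
    using frechet_derivative_at[OF assms(2)[OF that]] by simp
  then have "Ck_on n S (\<lambda>x. frechet_derivative f (at x) v)" for v
    using Ck_on_cong[OF assms(1), of "\<lambda>x. frechet_derivative f (at x) v" "\<lambda>x. f' x v"] assms(3)
    by blast
  then show ?thesis using assms(2) by (auto simp: differentiable_def)
qed

lemma Ck_on_Suc_has_derivative:
  assumes "Ck_on (Suc n) S f" "x \<in> S"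
  shows "(f has_derivative frechet_derivative f (at x)) (at x)"
  using assms by (simp add: frechet_derivative_works)

lemma Ck_on_SucD: "Ck_on (Suc n) S f \<Longrightarrow> Ck_on n S f"
proof (induction n arbitrary: f)
  case 0
  then show ?case
    by (auto intro!: continuous_at_imp_continuous_on differentiable_imp_continuous_within)
next
  case (Suc n)
  have "Ck_on n S (\<lambda>x. frechet_derivative f (at x) v)" for v
    using Suc by (metis Ck_on.simps(2))
  then show ?case using Suc.prems by simp
qed

lemma Ck_on_const: "open S \<Longrightarrow> Ck_on n S (\<lambda>x. c)"
proof (induction n arbitrary: c)
  case (Suc n)
  show ?case
    by (rule Ck_on_SucI[where f' = "\<lambda>_ _. 0"]) (use Suc in auto)
qed simp

lemma Ck_on_bounded_linear: "open S \<Longrightarrow> bounded_linear f \<Longrightarrow> Ck_on n S f"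
proof (cases n)
  case 0
  assume "bounded_linear f"
  with 0 show ?thesis by (simp add: linear_continuous_on)
next
  case (Suc n)
  assume "open S" "bounded_linear f"
  then show ?thesis unfolding Suc
    by (intro Ck_on_SucI[where f' = "\<lambda>_. f"] Ck_on_const bounded_linear_imp_has_derivative)
qed

lemma Ck_on_bounded_linear_compose:
  "open S \<Longrightarrow> bounded_linear h \<Longrightarrow> Ck_on n S f \<Longrightarrow> Ck_on n S (\<lambda>x. h (f x))"
proof (induction n arbitrary: f)
  case 0
  then show ?case by (simp add: bounded_linear.continuous_on)
next
  case (Suc n)
  show ?case
  proof (rule Ck_on_SucI[where f' = "\<lambda>x v. h (frechet_derivative f (at x) v)"])
    show "((\<lambda>x. h (f x)) has_derivative (\<lambda>v. h (frechet_derivative f (at x) v))) (at x)"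
      if "x \<in> S" for x
      using Ck_on_Suc_has_derivative[OF Suc.prems(3) that]
      by (rule bounded_linear.has_derivative[OF Suc.prems(2)])
    show "Ck_on n S (\<lambda>x. h (frechet_derivative f (at x) v))" for v
      by (rule Suc.IH) (use Suc.prems in simp_all)
  qed (rule Suc.prems(1))
qed

lemma Ck_on_add: "open S \<Longrightarrow> Ck_on n S f \<Longrightarrow> Ck_on n S g \<Longrightarrow> Ck_on n S (\<lambda>x. f x + g x)"
proof (induction n arbitrary: f g)
  case 0
  then show ?case by (simp add: continuous_on_add)
next
  case (Suc n)
  show ?case
  proof (rule Ck_on_SucI[OF Suc.prems(1) has_derivative_add[where
          f' = "frechet_derivative f (at _)" and g' = "frechet_derivative g (at _)"]])
    show "Ck_on n S (\<lambda>x. frechet_derivative f (at x) v + frechet_derivative g (at x) v)" for v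
      by (rule Suc.IH) (use Suc.prems in simp_all)
  qed (rule Ck_on_Suc_has_derivative[OF Suc.prems(2)] Ck_on_Suc_has_derivative[OF Suc.prems(3)], assumption)+
qed

lemma Ck_on_sum:
  "open S \<Longrightarrow> (\<And>i. i \<in> A \<Longrightarrow> Ck_on n S (f i)) \<Longrightarrow> Ck_on n S (\<lambda>x. \<Sum>i\<in>A. f i x)"
proof (induction A rule: infinite_finite_induct)
  case (insert i A)
  then have "Ck_on n S (\<lambda>x. f i x + (\<Sum>i\<in>A. f i x))"
    by (intro Ck_on_add) simp_all
  then show ?case using insert.hyps by simp
qed (simp_all add: Ck_on_const)

lemma Ck_on_scaleR:
  fixes f :: "'a::real_normed_vector \<Rightarrow> real"
  shows "open S \<Longrightarrow> Ck_on n S f \<Longrightarrow> Ck_on n S g \<Longrightarrow> Ck_on n S (\<lambda>x. f x *\<^sub>R g x)"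
proof (induction n arbitrary: f g)
  case 0
  then show ?case by (simp add: continuous_on_scaleR)
next
  case (Suc n)
  show ?case
  proof (rule Ck_on_SucI[OF Suc.prems(1) has_derivative_scaleR[where
          f' = "frechet_derivative f (at _)" and g' = "frechet_derivative g (at _)"]])
    \<comment> \<open>The product rule returns f and g undifferentiated; their order is lowered by
      \<open>Ck_on_SucD\<close>.\<close>
    show "Ck_on n S (\<lambda>x. f x *\<^sub>R frechet_derivative g (at x) v
        + frechet_derivative f (at x) v *\<^sub>R g x)" for v
      by (intro Ck_on_add Suc.IH Suc.prems(1)) (use Suc.prems Ck_on_SucD in auto)
  qed (use Ck_on_Suc_has_derivative Suc.prems in auto)
qed

lemma Ck_on_Pair: "open S \<Longrightarrow> Ck_on n S f \<Longrightarrow> Ck_on n S g \<Longrightarrow> Ck_on n S (\<lambda>x. (f x, g x))"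
proof (induction n arbitrary: f g)
  case 0
  then show ?case by (simp add: continuous_on_Pair)
next
  case (Suc n)
  show ?case
  proof (rule Ck_on_SucI[OF Suc.prems(1) has_derivative_Pair[where
          f' = "frechet_derivative f (at _)" and g' = "frechet_derivative g (at _)"]])
    show "Ck_on n S (\<lambda>x. (frechet_derivative f (at x) v, frechet_derivative g (at x) v))" for v
      by (rule Suc.IH) (use Suc.prems in simp_all)
  qed (rule Ck_on_Suc_has_derivative[OF Suc.prems(2)] Ck_on_Suc_has_derivative[OF Suc.prems(3)], assumption)+
qed

text \<open>Expanding the inner derivative in a basis of the finite-dimensional intermediate space
  reduces the chain rule to sums of products of lower order.\<close>

lemma Ck_on_compose:
  fixes f :: "'b::real_normed_vector \<Rightarrow> 'c::real_normed_vector"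
    and g :: "'a::real_normed_vector \<Rightarrow> 'b"
  assumes "finite_dim TYPE('b)" "open S" "open T" "g ` S \<subseteq> T" "Ck_on n T f" "Ck_on n S g"
  shows "Ck_on n S (\<lambda>x. f (g x))"
  using assms(5,6)
proof (induction n arbitrary: f)
  case 0
  then show ?case using assms(4) by (auto intro: continuous_on_compose2)
next
  case (Suc n)
  obtain B :: "'b set" and \<phi> where B: "finite B" "\<And>b. bounded_linear (\<phi> b)"
    and ex: "\<And>x. x = (\<Sum>b\<in>B. \<phi> b x *\<^sub>R b)"
    using finite_dim_coordinates[OF assms(1)] by blast
  let ?f' = "\<lambda>y. frechet_derivative f (at y)" and ?g' = "\<lambda>x. frechet_derivative g (at x)"
  have f': "(f has_derivative ?f' y) (at y)" if "y \<in> T" for y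
    using Ck_on_Suc_has_derivative[OF Suc.prems(1) that] .
  have g': "(g has_derivative ?g' x) (at x)" if "x \<in> S" for x
    using Ck_on_Suc_has_derivative[OF Suc.prems(2) that] .
  show ?case
  proof (rule Ck_on_SucI[OF assms(2)])
    fix x assume x: "x \<in> S"
    then have y: "g x \<in> T" using assms(4) by auto
    have eq: "?f' (g x) v = (\<Sum>b\<in>B. \<phi> b v *\<^sub>R ?f' (g x) b)" for v
      using arg_cong[OF ex, of "?f' (g x)" v] has_derivative_linear[OF f'[OF y]]
      by (simp add: linear_sum linear_scale)
    show "((\<lambda>x. f (g x)) has_derivative (\<lambda>v. \<Sum>b\<in>B. \<phi> b (?g' x v) *\<^sub>R ?f' (g x) b)) (at x)"
      using diff_chain_at[OF g'[OF x] f'[OF y]] unfolding o_def eq[of "?g' x _"] .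
  next
    fix v
    show "Ck_on n S (\<lambda>x. \<Sum>b\<in>B. \<phi> b (?g' x v) *\<^sub>R ?f' (g x) b)"
    proof (intro Ck_on_sum Ck_on_scaleR assms(2))
      have "Ck_on n S (\<lambda>x. ?g' x v)" using Suc.prems(2) by simp
      then show "Ck_on n S (\<lambda>x. \<phi> b (?g' x v))" for b
        by (rule Ck_on_bounded_linear_compose[OF assms(2) B(2)])
      show "Ck_on n S (\<lambda>x. ?f' (g x) b)" for b
        by (rule Suc.IH) (use Suc.prems(1) Ck_on_SucD[OF Suc.prems(2)] in simp_all)
    qed
  qed
qed

section \<open>Ordinary differential equations\<close>

lemma has_vector_derivative_bound:
  fixes F :: "real \<Rightarrow> 'a::real_normed_vector"
  assumes "convex S" "\<And>t. t \<in> S \<Longrightarrow> (F has_vector_derivative f t) (at t within S)"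
    and "\<And>t. t \<in> S \<Longrightarrow> norm (f t) \<le> B" "s \<in> S" "t \<in> S"
  shows "norm (F t - F s) \<le> B * \<bar>t - s\<bar>"
proof -
  have "onorm (\<lambda>h. h *\<^sub>R f t) \<le> B" if "t \<in> S" for t
    using assms(3)[OF that] order_trans[OF norm_ge_zero]
    by (intro onorm_bound) (auto simp: mult.commute[of B] intro!: mult_left_mono)
  then show ?thesis
    using differentiable_bound[OF assms(1), of F "\<lambda>t h. h *\<^sub>R f t" B t s] assms(2,4,5)
    by (simp add: has_vector_derivative_def)
qed

text \<open>The fixed point theorem is run in the complete space of bounded continuous functions on
  the whole line, with time clamped by k to a compact interval; the fixed point solves the equation
  inside that interval.\<close>

lemma picard_local_solution:
  fixes f :: "'a::banach \<Rightarrow> 'a"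
  assumes "r > 0" "L \<ge> 0"
    and lip: "\<And>x y. x \<in> cball x0 r \<Longrightarrow> y \<in> cball x0 r \<Longrightarrow> norm (f x - f y) \<le> L * norm (x - y)"
  obtains \<epsilon> c where "\<epsilon> > 0" "c 0 = x0"
    "\<And>t. \<bar>t\<bar> < \<epsilon> \<Longrightarrow> c t \<in> cball x0 r"
    "\<And>t. \<bar>t\<bar> < \<epsilon> \<Longrightarrow> (c has_vector_derivative f (c t)) (at t)"
proof -
  define M where "M = norm (f x0) + L * r"
  have M: "norm (f x) \<le> M" if "x \<in> cball x0 r" for x
  proof -
    have "norm (f x - f x0) \<le> L * norm (x - x0)"
      using lip that assms(1) by auto
    also have "\<dots> \<le> L * r"
      using that assms(2) by (intro mult_left_mono) (auto simp: dist_norm norm_minus_commute)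
    finally show ?thesis
      unfolding M_def using norm_triangle_sub[of "f x" "f x0"] by linarith
  qed
  have M0: "M \<ge> 0" using assms(1,2) by (simp add: M_def)
  \<comment> \<open>The first bound keeps the curve within distance r of x0, as its speed is at most
    M; the second makes the integral operator contract by 1/2. Adding 1 keeps both denominators
    positive.\<close>
  define \<delta> where "\<delta> = min (r / (M + 1)) (1 / (2 * (L + 1)))"
  have \<delta>: "\<delta> > 0" using assms(1,2) M0 by (simp add: \<delta>_def)
  have \<delta>M: "M * \<delta> \<le> r"
  proof -
    have "M * \<delta> \<le> (M + 1) * (r / (M + 1))"
      using M0 \<delta> by (intro mult_mono) (auto simp: \<delta>_def)
    then show ?thesis using M0 by simp
  qed
  have \<delta>L: "L * \<delta> \<le> 1 / 2"
  proof -
    have "L * \<delta> \<le> (L + 1) * (1 / (2 * (L + 1)))"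
      using assms(2) \<delta> by (intro mult_mono) (auto simp: \<delta>_def)
    also have "\<dots> = 1 / 2" using assms(2) by (simp add: field_simps)
    finally show ?thesis .
  qed
  define J where "J = {-\<delta>..\<delta>}"
  have J: "convex J" "0 \<in> J" using \<delta> by (auto simp: J_def)
  define k where "k = (\<lambda>t::real. max (-\<delta>) (min \<delta> t))"
  have k: "k t \<in> J" "continuous_on UNIV k" for t
    using \<delta> by (auto simp: J_def k_def intro!: continuous_intros)
  \<comment> \<open>Integrating from the left end covers all of J at once; subtracting
    \<open>P u 0\<close> in \<Phi> then gives the signed integral from 0.\<close>
  define P where "P = (\<lambda>u::real \<Rightarrow>\<^sub>C 'a. \<lambda>t. integral {-\<delta>..t} (\<lambda>s. f (u s)))"
  define S where "S = (PiC UNIV (\<lambda>_. cball x0 r) :: (real \<Rightarrow>\<^sub>C 'a) set)"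
  have S: "u \<in> S \<longleftrightarrow> (\<forall>t. u t \<in> cball x0 r)" for u
    by (auto simp: S_def mem_PiC_iff Pi_iff)
  have contf: "continuous_on (cball x0 r) f"
    by (rule lipschitz_on_continuous_on[of L])
       (use lip assms(2) in \<open>auto intro!: lipschitz_onI simp: dist_norm\<close>)
  have P: "(P u has_vector_derivative f (u t)) (at t within J)" if "u \<in> S" "t \<in> J" for u t
  proof -
    have "continuous_on {-\<delta>..\<delta>} (\<lambda>s. f (u s))"
      by (rule continuous_on_compose2[OF contf]) (use that(1) in \<open>auto simp: S\<close>)
    then show ?thesis
      using integral_has_vector_derivative that(2) unfolding P_def J_def by blast
  qed
  define \<Phi> where "\<Phi> = (\<lambda>u t. x0 + (P u (k t) - P u 0))"
  have \<Phi>r: "\<Phi> u t \<in> cball x0 r" if "u \<in> S" for u t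
  proof -
    have "norm (P u (k t) - P u 0) \<le> M * \<bar>k t - 0\<bar>"
      by (rule has_vector_derivative_bound[OF J(1) P[OF that]]) (use that k J(2) in \<open>auto simp: S M\<close>)
    also have "\<dots> \<le> M * \<delta>"
      using k(1)[of t] M0 by (intro mult_left_mono) (auto simp: J_def)
    finally show ?thesis using \<delta>M by (simp add: \<Phi>_def dist_norm norm_minus_commute)
  qed
  have \<Phi>c: "\<Phi> u \<in> bcontfun" if "u \<in> S" for u
  proof (rule bcontfun_normI)
    have "continuous_on J (P u)"
      using P[OF that] by (auto simp: continuous_on_eq_continuous_within
          intro: has_vector_derivative_continuous)
    then have "continuous_on UNIV (\<lambda>t. P u (k t))"
      by (rule continuous_on_compose2[OF _ k(2)]) (use k(1) in auto)
    then show "continuous_on UNIV (\<Phi> u)"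
      unfolding \<Phi>_def by (intro continuous_intros)
    show "norm (\<Phi> u t) \<le> norm x0 + r" for t
      using \<Phi>r[OF that, of t] norm_triangle_sub[of "\<Phi> u t" x0]
      by (simp add: dist_norm norm_minus_commute)
  qed
  define T where "T = (\<lambda>u. Bcontfun (\<Phi> u))"
  have T: "apply_bcontfun (T u) = \<Phi> u" if "u \<in> S" for u
    unfolding T_def using \<Phi>c[OF that] by (rule Bcontfun_inverse)
  have "\<exists>!u\<in>S. T u = u"
  proof (rule Banach_fix[where c = "1/2"])
    show "complete S"
      unfolding S_def complete_eq_closed by (intro closed_PiC) auto
    have "const_bcontfun x0 \<in> S" using assms(1) by (simp add: S)
    then show "S \<noteq> {}" by blast
    show "T ` S \<subseteq> S"
    proof (clarify, subst S, clarify)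
      fix u t assume "u \<in> S" then show "apply_bcontfun (T u) t \<in> cball x0 r"
        using \<Phi>r T by metis
    qed
    fix u v assume uv: "u \<in> S" "v \<in> S"
    show "dist (T u) (T v) \<le> 1 / 2 * dist u v"
    proof (rule dist_bound)
      fix t
      have "norm ((P u (k t) - P v (k t)) - (P u 0 - P v 0)) \<le> (L * dist u v) * \<bar>k t - 0\<bar>"
      proof (rule has_vector_derivative_bound[OF J(1)])
        fix s assume s: "s \<in> J"
        show "((\<lambda>t. P u t - P v t) has_vector_derivative f (u s) - f (v s)) (at s within J)"
          by (intro has_vector_derivative_diff P uv s)
        have "norm (f (u s) - f (v s)) \<le> L * norm (u s - v s)"
          using lip uv S by blast
        also have "\<dots> \<le> L * dist u v"
          using assms(2) dist_bounded[of u s v] by (intro mult_left_mono) (auto simp: dist_norm)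
        finally show "norm (f (u s) - f (v s)) \<le> L * dist u v" .
      qed (use k J in auto)
      also have "\<dots> \<le> (L * dist u v) * \<delta>"
        using k(1)[of t] assms(2) by (intro mult_left_mono) (auto simp: J_def)
      also have "\<dots> \<le> 1 / 2 * dist u v"
        using mult_right_mono[OF \<delta>L, of "dist u v"] by (simp add: mult_ac)
      finally show "dist (T u t) (T v t) \<le> 1 / 2 * dist u v"
        by (simp add: T uv \<Phi>_def dist_norm algebra_simps)
    qed
  qed auto
  then obtain u where u: "u \<in> S" "T u = u" by blast
  have u_eq: "u t = \<Phi> u t" for t using T[OF u(1)] u(2) by simp
  show ?thesis
  proof (rule that[of \<delta> u])
    show "u 0 = x0" using u_eq[of 0] \<delta> by (simp add: \<Phi>_def k_def)
    show "u t \<in> cball x0 r" for t using u(1) S by blast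
    fix t :: real assume t: "\<bar>t\<bar> < \<delta>"
    have "(P u has_vector_derivative f (u t)) (at t within J)"
      by (rule P[OF u(1)]) (use t in \<open>auto simp: J_def\<close>)
    moreover have "at t within J = at t"
      using t at_within_interior[of t J] by (simp add: J_def interior_atLeastAtMost_real abs_less_iff)
    ultimately have D: "((\<lambda>t. x0 + (P u t - P u 0)) has_vector_derivative f (u t)) (at t)"
      by (auto intro!: derivative_eq_intros)
    have E: "x0 + (P u s - P u 0) = u s" if "s \<in> {-\<delta><..<\<delta>}" for s
      using that u_eq[of s] by (simp add: \<Phi>_def k_def)
    show "(apply_bcontfun u has_vector_derivative f (u t)) (at t)"
      by (rule has_vector_derivative_transform_within_open[OF D, where S = "{-\<delta><..<\<delta>}"])
         (use t E in auto)
  qed (use \<delta> in auto)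
qed

lemma C1_locally_lipschitz:
  fixes f :: "'a::real_normed_vector \<Rightarrow> 'b::real_normed_vector"
  assumes "finite_dim TYPE('a)" "open T" "Ck_on 1 T f" "x0 \<in> T"
  obtains r L where "r > 0" "L \<ge> 0" "cball x0 r \<subseteq> T"
    "\<And>x y. x \<in> cball x0 r \<Longrightarrow> y \<in> cball x0 r \<Longrightarrow> norm (f x - f y) \<le> L * norm (x - y)"
proof -
  obtain B :: "'a set" and \<phi> where B: "finite B" "\<And>b. bounded_linear (\<phi> b)"
    and ex: "\<And>x. x = (\<Sum>b\<in>B. \<phi> b x *\<^sub>R b)"
    using finite_dim_coordinates[OF assms(1)] by blast
  let ?f' = "\<lambda>x. frechet_derivative f (at x)"
  \<comment> \<open>\<open>Ck_on\<close> provides continuity of the derivative only along fixed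
    vectors; summing over a basis yields a continuous bound for its operator norm.\<close>
  define A where "A = (\<lambda>x. \<Sum>b\<in>B. onorm (\<phi> b) * norm (?f' x b))"
  have f': "(f has_derivative ?f' x) (at x)" if "x \<in> T" for x
    by (rule Ck_on_Suc_has_derivative[of 0 T]) (use assms(3) that in auto)
  have "continuous_on T (\<lambda>x. ?f' x b)" for b
    using assms(3) unfolding One_nat_def Ck_on.simps by blast
  then have "continuous_on T A"
    unfolding A_def by (intro continuous_intros)
  then have "isCont A x0"
    using assms(2,4) continuous_on_eq_continuous_at by blast
  then have "\<forall>\<^sub>F x in at x0. A x < A x0 + 1"
    by (intro order_tendstoD(2)[of A "A x0"]) (auto simp: isCont_def)
  then obtain d where d: "d > 0" "\<And>x. x \<noteq> x0 \<Longrightarrow> dist x x0 < d \<Longrightarrow> A x < A x0 + 1"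
    by (auto simp: eventually_at)
  obtain e where e: "e > 0" "cball x0 e \<subseteq> T"
    using assms(2,4) open_contains_cball by blast
  define r where "r = min e (d / 2)"
  have r: "r > 0" "cball x0 r \<subseteq> T" using d(1) e by (auto simp: r_def)
  have A: "A x \<le> A x0 + 1" if "x \<in> cball x0 r" for x
  proof (cases "x = x0")
    case False
    have "dist x x0 < d" using that d(1) by (auto simp: r_def dist_commute)
    then show ?thesis using d(2)[OF False] by simp
  qed simp
  have on: "onorm (?f' x) \<le> A x" if "x \<in> T" for x
  proof (rule onorm_bound)
    show "A x \<ge> 0" unfolding A_def by (intro sum_nonneg mult_nonneg_nonneg onorm_pos_le B(2)) auto
    fix v
    have "?f' x v = (\<Sum>b\<in>B. \<phi> b v *\<^sub>R ?f' x b)"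
      using arg_cong[OF ex, of "?f' x" v] has_derivative_linear[OF f'[OF that]]
      by (simp add: linear_sum linear_scale)
    also have "norm \<dots> \<le> (\<Sum>b\<in>B. norm (\<phi> b v) * norm (?f' x b))"
      by (rule order_trans[OF norm_sum]) simp
    also have "\<dots> \<le> (\<Sum>b\<in>B. (onorm (\<phi> b) * norm v) * norm (?f' x b))"
      by (intro sum_mono mult_right_mono onorm B(2)) auto
    also have "\<dots> = A x * norm v"
      unfolding A_def sum_distrib_right by (simp add: mult_ac)
    finally show "norm (?f' x v) \<le> A x * norm v" .
  qed
  have "norm (f x - f y) \<le> (A x0 + 1) * norm (x - y)"
    if "x \<in> cball x0 r" "y \<in> cball x0 r" for x y
  proof (rule differentiable_bound[OF convex_cball _ _ that])
    fix z assume z: "z \<in> cball x0 r"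
    show "(f has_derivative ?f' z) (at z within cball x0 r)"
      using f' z r(2) has_derivative_at_withinI by blast
    show "onorm (?f' z) \<le> A x0 + 1" using on A z r(2) by (meson order_trans subsetD)
  qed
  moreover have "A x0 + 1 \<ge> 0"
    unfolding A_def by (intro add_nonneg_nonneg sum_nonneg mult_nonneg_nonneg onorm_pos_le B(2)) auto
  ultimately show ?thesis using that[of r "A x0 + 1"] r by blast
qed

text \<open>Smoothness is bootstrapped: if c has order n, so does f along c, which is the derivative
  of c.\<close>

lemma smooth_ode_local_solution:
  fixes f :: "'a::banach \<Rightarrow> 'a"
  assumes "finite_dim TYPE('a)" "open T" "smooth_on T f" "x0 \<in> T"
  obtains \<epsilon> c where "\<epsilon> > 0" "c 0 = x0" "smooth_on {-\<epsilon><..<\<epsilon>} c"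
    "\<And>t. t \<in> {-\<epsilon><..<\<epsilon>} \<Longrightarrow> c t \<in> T"
    "\<And>t. t \<in> {-\<epsilon><..<\<epsilon>} \<Longrightarrow> (c has_vector_derivative f (c t)) (at t)"
proof -
  have "Ck_on 1 T f" using assms(3) smooth_on_def by blast
  then obtain r L where r: "r > 0" "L \<ge> 0" "cball x0 r \<subseteq> T"
    and lip: "\<And>x y. x \<in> cball x0 r \<Longrightarrow> y \<in> cball x0 r \<Longrightarrow> norm (f x - f y) \<le> L * norm (x - y)"
    using C1_locally_lipschitz[OF assms(1,2) _ assms(4)] by metis
  obtain \<epsilon> c where c: "\<epsilon> > 0" "c 0 = x0" "\<And>t. \<bar>t\<bar> < \<epsilon> \<Longrightarrow> c t \<in> cball x0 r"
    "\<And>t. \<bar>t\<bar> < \<epsilon> \<Longrightarrow> (c has_vector_derivative f (c t)) (at t)"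
    using picard_local_solution[OF r(1,2) lip] by metis
  let ?S = "{-\<epsilon><..<\<epsilon>}"
  have der: "(c has_vector_derivative f (c t)) (at t)" and T: "c t \<in> T" if "t \<in> ?S" for t
    using c(3,4)[of t] that r(3) by (auto simp: abs_less_iff)
  have "Ck_on n ?S c" for n
  proof (induction n)
    case 0
    then show ?case
      using has_vector_derivative_continuous[OF der] by (auto intro: continuous_at_imp_continuous_on)
  next
    case (Suc n)
    show ?case
    proof (rule Ck_on_SucI)
      show "(c has_derivative (\<lambda>h. h *\<^sub>R f (c t))) (at t)" if "t \<in> ?S" for t
        using der[OF that] by (simp add: has_vector_derivative_def)
      have "Ck_on n ?S (\<lambda>t. f (c t))"
        by (rule Ck_on_compose[OF assms(1) _ assms(2) _ _ Suc])
           (use T assms(3) in \<open>auto simp: smooth_on_def\<close>)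
      then show "Ck_on n ?S (\<lambda>t. h *\<^sub>R f (c t))" for h
        by (intro Ck_on_scaleR Ck_on_const) auto
    qed simp
  qed
  then show ?thesis using that[of \<epsilon> c] c(1,2) der T by (simp add: smooth_on_def)
qed

section \<open>Charts, smooth maps and velocities\<close>

text \<open>The part of \<open>smooth_manifold\<close> that makes sense without separation and countability
  conditions on the type of points, so that it also applies to \<open>vector_atlas\<close>.\<close>

definition charted :: "('m::topological_space, 'a::real_normed_vector) atlas \<Rightarrow> bool" where
  "charted C \<longleftrightarrow> finite_dim TYPE('a) \<and>
     (\<forall>p. p \<in> chart_dom C p \<and> open (chart_dom C p) \<and> open (chart C p ` chart_dom C p) \<and>
          homeomorphism (chart_dom C p) (chart C p ` chart_dom C p) (chart C p) (chart_inv C p))"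

lemma smooth_manifold_charted: "smooth_manifold C \<Longrightarrow> charted C"
  unfolding smooth_manifold_def charted_def finite_dim_def by blast

lemma charted_finite_dim:
  fixes C :: "('m::topological_space, 'a::real_normed_vector) atlas"
  shows "charted C \<Longrightarrow> finite_dim TYPE('a)"
  by (simp add: charted_def)

lemma chart_dom_self: "charted C \<Longrightarrow> p \<in> chart_dom C p"
  by (simp add: charted_def)

lemma open_chart_dom: "charted C \<Longrightarrow> open (chart_dom C p)"
  by (simp add: charted_def)

lemma open_chart_range: "charted C \<Longrightarrow> open (chart C p ` chart_dom C p)"
  by (simp add: charted_def)

lemma chart_homeomorphism:
  "charted C \<Longrightarrow> homeomorphism (chart_dom C p) (chart C p ` chart_dom C p) (chart C p) (chart_inv C p)"
  by (simp add: charted_def)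

lemma chart_inv_chart: "charted C \<Longrightarrow> x \<in> chart_dom C p \<Longrightarrow> chart_inv C p (chart C p x) = x"
  using chart_homeomorphism homeomorphism_apply1 by blast

lemma continuous_on_chart: "charted C \<Longrightarrow> continuous_on (chart_dom C p) (chart C p)"
  using chart_homeomorphism homeomorphism_def by blast

lemma continuous_on_chart_inv:
  "charted C \<Longrightarrow> continuous_on (chart C p ` chart_dom C p) (chart_inv C p)"
  using chart_homeomorphism homeomorphism_def by blast

lemma isCont_chart_inv: "charted C \<Longrightarrow> x \<in> chart_dom C p \<Longrightarrow> isCont (chart_inv C p) (chart C p x)"
  using continuous_on_chart_inv open_chart_range continuous_on_eq_continuous_at by blast

lemma open_chart_image:
  assumes "charted C" "open U" "U \<subseteq> chart_dom C p"
  shows "open (chart C p ` U)"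
proof -
  have "openin (top_of_set (chart_dom C p)) U"
    using assms by (simp add: open_subset)
  then show ?thesis
    using homeomorphism_imp_open_map[OF chart_homeomorphism[OF assms(1)]] open_chart_range[OF assms(1)]
      openin_open_trans by blast
qed

section \<open>Atlases of vector spaces and of products\<close>

lemma chart_dom_vector_atlas [simp]: "chart_dom vector_atlas p = UNIV"
  and chart_vector_atlas [simp]: "chart vector_atlas p = id"
  and chart_inv_vector_atlas [simp]: "chart_inv vector_atlas p = id"
  by (auto simp: chart_dom_def chart_def vector_atlas_def chart_inv_def)

lemma charted_vector_atlas:
  "finite_dim TYPE('a::real_normed_vector) \<Longrightarrow> charted (vector_atlas :: ('a, 'a) atlas)"
  by (simp add: charted_def homeomorphism_def)

lemma chart_dom_prod_atlas [simp]:
    "chart_dom (prod_atlas C D) (p, q) = chart_dom C p \<times> chart_dom D q"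
  and chart_prod_atlas [simp]:
    "chart (prod_atlas C D) (p, q) = map_prod (chart C p) (chart D q)"
  by (auto simp: prod_atlas_def chart_dom_def chart_def)

text \<open>\<open>chart_inv\<close> is an \<open>inv_into\<close>, hence arbitrary off the chart
  image; on the image it splits because the product chart is injective.\<close>

lemma chart_inv_prod_atlas:
  assumes "charted C" "charted D" "u \<in> chart C p ` chart_dom C p" "v \<in> chart D q ` chart_dom D q"
  shows "chart_inv (prod_atlas C D) (p, q) (u, v) = (chart_inv C p u, chart_inv D q v)"
proof -
  have inj: "inj_on (chart C p) (chart_dom C p)" "inj_on (chart D q) (chart_dom D q)"
    using assms chart_inv_chart by (metis inj_onI)+
  have "inj_on (map_prod (chart C p) (chart D q)) (chart_dom C p \<times> chart_dom D q)"
    using inj by (rule map_prod_inj_on)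
  from inv_into_f_f[OF this] show ?thesis
    using assms by (force simp: chart_inv_def inv_into_f_f inj)
qed

lemma charted_prod_atlas:
  assumes "charted C" "charted D"
  shows "charted (prod_atlas C D)"
proof -
  have "homeomorphism (chart_dom C p \<times> chart_dom D q) (chart C p ` chart_dom C p \<times> chart D q ` chart_dom D q)
     (map_prod (chart C p) (chart D q)) (chart_inv (prod_atlas C D) (p, q))" for p q
  proof -
    have "continuous_on (chart_dom C p \<times> chart_dom D q) (\<lambda>x. (chart C p (fst x), chart D q (snd x)))"
      by (intro continuous_on_Pair continuous_on_compose2[OF continuous_on_chart[OF assms(1)]]
          continuous_on_compose2[OF continuous_on_chart[OF assms(2)]] continuous_intros) auto
    moreover have "continuous_on (chart C p ` chart_dom C p \<times> chart D q ` chart_dom D q)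
        (\<lambda>x. (chart_inv C p (fst x), chart_inv D q (snd x)))"
      by (intro continuous_on_Pair continuous_on_compose2[OF continuous_on_chart_inv[OF assms(1)]]
          continuous_on_compose2[OF continuous_on_chart_inv[OF assms(2)]] continuous_intros) auto
    moreover have "chart_inv (prod_atlas C D) (p, q) x = (chart_inv C p (fst x), chart_inv D q (snd x))"
      if "x \<in> chart C p ` chart_dom C p \<times> chart D q ` chart_dom D q" for x
      using that chart_inv_prod_atlas[OF assms] by (cases x) auto
    ultimately show ?thesis
      by (auto simp: homeomorphism_def map_prod_def case_prod_unfold chart_inv_chart assms
          image_iff cong: continuous_on_cong_simp) (force simp: chart_inv_chart assms)+
  qed
  moreover have "map_prod (chart C p) (chart D q) ` (chart_dom C p \<times> chart_dom D q)
      = chart C p ` chart_dom C p \<times> chart D q ` chart_dom D q" for p q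
    by (rule map_prod_surj_on) auto
  ultimately show ?thesis
    using assms by (auto simp: charted_def finite_dim_prod open_Times)
qed

section \<open>Smooth maps: composition, pairing, projections\<close>

lemma open_smooth_map_domain:
  assumes "charted C" "charted D" "continuous_on UNIV f"
  shows "open (chart C p ` (chart_dom C p \<inter> f -` chart_dom D q))"
  by (intro open_chart_image assms open_Int open_vimage open_chart_dom) auto

lemma smooth_map_continuous: "smooth_map C D f \<Longrightarrow> continuous_on UNIV f"
  by (simp add: smooth_map_def)

lemma smooth_map_Ck:
  "smooth_map C D f \<Longrightarrow>
   Ck_on n (chart C p ` (chart_dom C p \<inter> f -` chart_dom D q)) (chart D q \<circ> f \<circ> chart_inv C p)"
  by (simp add: smooth_map_def smooth_on_def)

lemma smooth_map_has_derivative: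
  assumes "smooth_map C D f" "x \<in> chart_dom C p" "f x \<in> chart_dom D q"
  shows "((chart D q \<circ> f \<circ> chart_inv C p) has_derivative
     frechet_derivative (chart D q \<circ> f \<circ> chart_inv C p) (at (chart C p x))) (at (chart C p x))"
  using assms by (intro Ck_on_Suc_has_derivative[OF smooth_map_Ck[OF assms(1)]]) auto

text \<open>The chart changes in \<open>smooth_manifold\<close> are the coordinate expressions of
  the identity; this is how their smoothness enters.\<close>

lemma smooth_map_id: "smooth_manifold C \<Longrightarrow> smooth_map C C (\<lambda>x. x)"
  by (auto simp: smooth_manifold_def smooth_map_def o_def)

lemma smooth_map_const:
  assumes "charted C"
  shows "smooth_map C D (\<lambda>_. y)"
  unfolding smooth_map_def smooth_on_def
proof (intro conjI allI)
  fix p q n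
  have "open (chart C p ` (chart_dom C p \<inter> (\<lambda>_. y) -` chart_dom D q))"
    using assms by (cases "y \<in> chart_dom D q") (auto simp: open_chart_range)
  then show "Ck_on n (chart C p ` (chart_dom C p \<inter> (\<lambda>_. y) -` chart_dom D q))
      (chart D q \<circ> (\<lambda>_. y) \<circ> chart_inv C p)"
    unfolding o_def by (rule Ck_on_const)
qed simp

text \<open>Near each x the chart indexed by f x serves as the intermediate one. It need not cover
  the image of the whole domain, which is why the claim is proved locally.\<close>

lemma smooth_map_compose:
  assumes "charted C" "charted D" "charted E" "smooth_map C D f" "smooth_map D E g"
  shows "smooth_map C E (\<lambda>x. g (f x))"
  unfolding smooth_map_def smooth_on_def
proof (intro conjI allI)
  have cf: "continuous_on UNIV f" and cg: "continuous_on UNIV g"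
    using assms(4,5) smooth_map_continuous by blast+
  show cgf: "continuous_on UNIV (\<lambda>x. g (f x))"
    by (rule continuous_on_compose2[OF cg cf]) simp
  fix p r n
  show "Ck_on n (chart C p ` (chart_dom C p \<inter> (\<lambda>x. g (f x)) -` chart_dom E r))
      (chart E r \<circ> (\<lambda>x. g (f x)) \<circ> chart_inv C p)"
  proof (rule Ck_on_local, clarify)
    fix x assume x: "x \<in> chart_dom C p" "g (f x) \<in> chart_dom E r"
    define q where "q = f x"
    have qx: "f x \<in> chart_dom D q" using chart_dom_self[OF assms(2)] q_def by simp
    let ?U = "chart_dom C p \<inter> f -` (chart_dom D q \<inter> g -` chart_dom E r)"
    let ?S = "chart C p ` ?U" and ?T = "chart D q ` (chart_dom D q \<inter> g -` chart_dom E r)"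
    have oT: "open ?T" by (rule open_smooth_map_domain[OF assms(2,3) cg])
    have "open ?U"
      by (intro open_Int open_chart_dom assms open_vimage cf cg)
    then have oS: "open ?S" by (intro open_chart_image assms(1)) auto
    have inv: "chart_inv C p (chart C p y) = y" if "y \<in> chart_dom C p" for y
      using chart_inv_chart[OF assms(1) that] .
    have Ck: "Ck_on n ?S (\<lambda>u. (chart E r \<circ> g \<circ> chart_inv D q) ((chart D q \<circ> f \<circ> chart_inv C p) u))"
    proof (rule Ck_on_compose[OF charted_finite_dim[OF assms(2)] oS oT])
      show "(chart D q \<circ> f \<circ> chart_inv C p) ` ?S \<subseteq> ?T"
        using inv by auto
      show "Ck_on n ?S (chart D q \<circ> f \<circ> chart_inv C p)"
        by (rule Ck_on_subset[OF smooth_map_Ck[OF assms(4), of n p q]]) auto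
    qed (rule smooth_map_Ck[OF assms(5)])
    have eq: "(chart E r \<circ> g \<circ> chart_inv D q) ((chart D q \<circ> f \<circ> chart_inv C p) u)
        = (chart E r \<circ> (\<lambda>x. g (f x)) \<circ> chart_inv C p) u" if "u \<in> ?S" for u
      using that chart_inv_chart[OF assms(2)] inv by auto
    have "Ck_on n ?S (chart E r \<circ> (\<lambda>x. g (f x)) \<circ> chart_inv C p)"
      using oS Ck eq by (rule Ck_on_transform)
    moreover have "chart C p x \<in> ?S" using x qx by auto
    ultimately show "\<exists>T. open T \<and> chart C p x \<in> T \<and>
        Ck_on n T (chart E r \<circ> (\<lambda>x. g (f x)) \<circ> chart_inv C p)"
      using oS by blast
  qed
qed

lemma smooth_map_Pair:
  fixes C :: "('m::topological_space, 'a::real_normed_vector) atlas"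
    and D :: "('n::topological_space, 'b::real_normed_vector) atlas"
    and E :: "('k::topological_space, 'c::real_normed_vector) atlas"
  assumes "charted C" "charted D" "charted E" "smooth_map C D f" "smooth_map C E g"
  shows "smooth_map C (prod_atlas D E) (\<lambda>x. (f x, g x))"
  unfolding smooth_map_def smooth_on_def
proof (intro conjI allI)
  show cont: "continuous_on UNIV (\<lambda>x. (f x, g x))"
    using assms(4,5) by (intro continuous_on_Pair smooth_map_continuous)
  fix p n and qr :: "'n \<times> 'k"
  obtain q r where qr: "qr = (q, r)" by fastforce
  let ?S = "chart C p ` (chart_dom C p \<inter> (\<lambda>x. (f x, g x)) -` chart_dom (prod_atlas D E) qr)"
  have "open ?S"
    by (intro open_smooth_map_domain charted_prod_atlas assms cont)
  then have "Ck_on n ?S (\<lambda>u. ((chart D q \<circ> f \<circ> chart_inv C p) u, (chart E r \<circ> g \<circ> chart_inv C p) u))"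
    by (rule Ck_on_Pair[OF _ Ck_on_subset[OF smooth_map_Ck[OF assms(4), of n p q]]
          Ck_on_subset[OF smooth_map_Ck[OF assms(5), of n p r]]]) (auto simp: qr)
  then show "Ck_on n ?S (chart (prod_atlas D E) qr \<circ> (\<lambda>x. (f x, g x)) \<circ> chart_inv C p)"
    by (simp add: qr o_def)
qed

lemma smooth_map_fst:
  fixes C :: "('m::{t2_space, second_countable_topology}, 'a::real_normed_vector) atlas"
    and D :: "('n::topological_space, 'b::real_normed_vector) atlas"
  assumes "smooth_manifold C" "charted D"
  shows "smooth_map (prod_atlas C D) C fst"
  unfolding smooth_map_def smooth_on_def
proof (intro conjI allI)
  note C = smooth_manifold_charted[OF assms(1)]
  fix p :: "'m \<times> 'n" and q n
  obtain p1 p2 where p: "p = (p1, p2)" by fastforce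
  let ?S = "chart (prod_atlas C D) p ` (chart_dom (prod_atlas C D) p \<inter> fst -` chart_dom C q)"
  let ?T = "chart C p1 ` (chart_dom C p1 \<inter> (\<lambda>x. x) -` chart_dom C q)"
  have oS: "open ?S"
    by (intro open_smooth_map_domain charted_prod_atlas assms C continuous_on_fst continuous_on_id)
  have Ck: "Ck_on n ?S (\<lambda>u. (chart C q \<circ> (\<lambda>x. x) \<circ> chart_inv C p1) (fst u))"
  proof (rule Ck_on_compose[where g = fst and T = ?T, OF charted_finite_dim[OF C] oS])
    show "open ?T" by (intro open_smooth_map_domain C continuous_on_id)
    show "Ck_on n ?T (chart C q \<circ> (\<lambda>x. x) \<circ> chart_inv C p1)"
      by (rule smooth_map_Ck[OF smooth_map_id[OF assms(1)]])
    show "Ck_on n ?S fst"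
      by (intro Ck_on_bounded_linear oS bounded_linear_fst)
  qed (auto simp: p)
  have eq: "(chart C q \<circ> (\<lambda>x. x) \<circ> chart_inv C p1) (fst u)
      = (chart C q \<circ> fst \<circ> chart_inv (prod_atlas C D) p) u" if "u \<in> ?S" for u
    using that chart_inv_prod_atlas[OF C assms(2)] by (auto simp: p)
  show "Ck_on n ?S (chart C q \<circ> fst \<circ> chart_inv (prod_atlas C D) p)"
    using oS Ck eq by (rule Ck_on_transform)
qed (intro continuous_on_fst continuous_on_id)

lemma smooth_map_snd:
  fixes C :: "('m::topological_space, 'a::real_normed_vector) atlas"
    and D :: "('n::{t2_space, second_countable_topology}, 'b::real_normed_vector) atlas"
  assumes "charted C" "smooth_manifold D"
  shows "smooth_map (prod_atlas C D) D snd"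
  unfolding smooth_map_def smooth_on_def
proof (intro conjI allI)
  note D = smooth_manifold_charted[OF assms(2)]
  fix p :: "'m \<times> 'n" and q n
  obtain p1 p2 where p: "p = (p1, p2)" by fastforce
  let ?S = "chart (prod_atlas C D) p ` (chart_dom (prod_atlas C D) p \<inter> snd -` chart_dom D q)"
  let ?T = "chart D p2 ` (chart_dom D p2 \<inter> (\<lambda>x. x) -` chart_dom D q)"
  have oS: "open ?S"
    by (intro open_smooth_map_domain charted_prod_atlas assms D continuous_on_snd continuous_on_id)
  have Ck: "Ck_on n ?S (\<lambda>u. (chart D q \<circ> (\<lambda>x. x) \<circ> chart_inv D p2) (snd u))"
  proof (rule Ck_on_compose[where g = snd and T = ?T, OF charted_finite_dim[OF D] oS])
    show "open ?T" by (intro open_smooth_map_domain D continuous_on_id)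
    show "Ck_on n ?T (chart D q \<circ> (\<lambda>x. x) \<circ> chart_inv D p2)"
      by (rule smooth_map_Ck[OF smooth_map_id[OF assms(2)]])
    show "Ck_on n ?S snd"
      by (intro Ck_on_bounded_linear oS bounded_linear_snd)
  qed (auto simp: p)
  have eq: "(chart D q \<circ> (\<lambda>x. x) \<circ> chart_inv D p2) (snd u)
      = (chart D q \<circ> snd \<circ> chart_inv (prod_atlas C D) p) u" if "u \<in> ?S" for u
    using that chart_inv_prod_atlas[OF assms(1) D] by (auto simp: p)
  show "Ck_on n ?S (chart D q \<circ> snd \<circ> chart_inv (prod_atlas C D) p)"
    using oS Ck eq by (rule Ck_on_transform)
qed (intro continuous_on_snd continuous_on_id)

text \<open>Velocity coordinates in the chart with an arbitrary index \<open>q\<close>, as opposed to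
  \<open>has_velocity\<close>, which uses the chart indexed by the current point.\<close>

definition chart_velocity ::
    "('m::topological_space, 'a::real_normed_vector) atlas \<Rightarrow> 'm \<Rightarrow> (real \<Rightarrow> 'm) \<Rightarrow> 'a \<Rightarrow> real \<Rightarrow> bool"
  where
  "chart_velocity C q c v t \<longleftrightarrow> isCont c t \<and> c t \<in> chart_dom C q \<and>
     ((\<lambda>s. chart C q (c s)) has_vector_derivative v) (at t)"

lemma has_velocity_iff: "charted C \<Longrightarrow> has_velocity C c v t \<longleftrightarrow> chart_velocity C (c t) c v t"
  by (simp add: has_velocity_def chart_velocity_def chart_dom_self)

lemma chart_velocity_unique: "chart_velocity C q c v t \<Longrightarrow> chart_velocity C q c w t \<Longrightarrow> v = w"
  unfolding chart_velocity_def using vector_derivative_unique_at by blast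

lemma has_velocity_unique: "has_velocity C c v t \<Longrightarrow> has_velocity C c w t \<Longrightarrow> v = w"
  unfolding has_velocity_def using vector_derivative_unique_at by blast

text \<open>The chain rule with both charts arbitrary. Charts indexed by the current points give
  \<open>tangent_map\<close>; other choices keep coordinates fixed while the point moves.\<close>

lemma chart_velocity_compose:
  assumes "charted C" "smooth_map C D f" "chart_velocity C q c v t" "f (c t) \<in> chart_dom D r"
  shows "chart_velocity D r (\<lambda>s. f (c s))
     (frechet_derivative (chart D r \<circ> f \<circ> chart_inv C q) (at (chart C q (c t))) v) t"
  unfolding chart_velocity_def
proof (intro conjI assms(4))
  have c: "isCont c t" "c t \<in> chart_dom C q" "((\<lambda>s. chart C q (c s)) has_vector_derivative v) (at t)"
    using assms(3) by (auto simp: chart_velocity_def)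
  show "isCont (\<lambda>s. f (c s)) t"
    using continuous_on_tendsto_compose[OF smooth_map_continuous[OF assms(2)]] c(1)
    by (simp add: isCont_def)
  let ?D = "frechet_derivative (chart D r \<circ> f \<circ> chart_inv C q) (at (chart C q (c t)))"
  have D: "((chart D r \<circ> f \<circ> chart_inv C q) has_derivative ?D) (at (chart C q (c t)))"
    by (rule smooth_map_has_derivative[OF assms(2) c(2) assms(4)])
  have der: "((\<lambda>s. (chart D r \<circ> f \<circ> chart_inv C q) (chart C q (c s))) has_vector_derivative ?D v) (at t)"
    using vector_derivative_diff_chain_within[OF c(3) has_derivative_at_withinI[OF D]]
    by (simp add: o_def)
  have "\<forall>\<^sub>F s in nhds t. (chart D r \<circ> f \<circ> chart_inv C q) (chart C q (c s)) = chart D r (f (c s))"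
  proof -
    have "\<forall>\<^sub>F s in nhds t. c s \<in> chart_dom C q"
      using c(1,2) open_chart_dom[OF assms(1)]
      by (metis isCont_def tendsto_at_iff_tendsto_nhds topological_tendstoD)
    then show ?thesis
      by eventually_elim (simp add: chart_inv_chart[OF assms(1)])
  qed
  then obtain U where "open U" "t \<in> U"
    "\<And>s. s \<in> U \<Longrightarrow> (chart D r \<circ> f \<circ> chart_inv C q) (chart C q (c s)) = chart D r (f (c s))"
    unfolding eventually_nhds by blast
  with der show "((\<lambda>s. chart D r (f (c s))) has_vector_derivative ?D v) (at t)"
    by (rule has_vector_derivative_transform_within_open)
qed

lemma has_velocity_compose:
  assumes "charted C" "charted D" "smooth_map C D f" "has_velocity C c v t"
  shows "has_velocity D (\<lambda>s. f (c s)) (tangent_map C D f (c t) v) t"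
  using chart_velocity_compose[OF assms(1,3), of "c t" c v t "f (c t)"] assms
  by (simp add: has_velocity_iff tangent_map_def chart_dom_self)

lemma chart_velocity_Pair:
  "chart_velocity (prod_atlas C D) (p, q) (\<lambda>s. (c s, d s)) (v, w) t \<longleftrightarrow>
   chart_velocity C p c v t \<and> chart_velocity D q d w t"
proof -
  have "isCont (\<lambda>s. (c s, d s)) t \<longleftrightarrow> isCont c t \<and> isCont d t"
  proof
    assume cont: "isCont (\<lambda>s. (c s, d s)) t"
    show "isCont c t \<and> isCont d t"
      using continuous_fst[OF cont] continuous_snd[OF cont] by simp
  next
    assume "isCont c t \<and> isCont d t"
    then show "isCont (\<lambda>s. (c s, d s)) t" by (intro continuous_Pair) blast+
  qed
  moreover have "((\<lambda>s. (chart C p (c s), chart D q (d s))) has_vector_derivative (v, w)) (at t) \<longleftrightarrow>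
    ((\<lambda>s. chart C p (c s)) has_vector_derivative v) (at t) \<and>
    ((\<lambda>s. chart D q (d s)) has_vector_derivative w) (at t)"
    (is "?l \<longleftrightarrow> ?r")
  proof
    assume ?l
    from bounded_linear.has_vector_derivative[OF bounded_linear_fst this]
      bounded_linear.has_vector_derivative[OF bounded_linear_snd this]
    show ?r by simp
  next
    assume ?r then show ?l
      unfolding has_vector_derivative_def scaleR_Pair by (auto intro: has_derivative_Pair)
  qed
  ultimately show ?thesis by (auto simp: chart_velocity_def)
qed

lemma has_velocity_Pair:
  assumes "charted C" "charted D"
  shows "has_velocity (prod_atlas C D) (\<lambda>s. (c s, d s)) (v, w) t \<longleftrightarrow>
    has_velocity C c v t \<and> has_velocity D d w t"
  by (simp add: has_velocity_iff assms charted_prod_atlas chart_velocity_Pair)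

lemma has_velocity_vector_atlas:
  "has_velocity vector_atlas c v t \<longleftrightarrow> (c has_vector_derivative v) (at t)"
  by (auto simp: has_velocity_def has_vector_derivative_continuous)

text \<open>The curve is a straight line in the chart. Such curves, with uniqueness of velocities,
  reduce identities of tangent maps to identities of curves.\<close>

lemma has_velocity_exists:
  assumes "charted C"
  obtains c where "c 0 = p" "has_velocity C c v 0"
proof (rule that)
  let ?x = "chart C p p"
  let ?c = "\<lambda>t. chart_inv C p (?x + t *\<^sub>R v)"
  have p: "p \<in> chart_dom C p" by (rule chart_dom_self[OF assms])
  show c0: "?c 0 = p" by (simp add: chart_inv_chart[OF assms p])
  let ?U = "(\<lambda>t. ?x + t *\<^sub>R v) -` (chart C p ` chart_dom C p)"
  have U: "open ?U"
    by (intro open_vimage open_chart_range assms continuous_intros)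
  have "isCont (\<lambda>t. ?x + t *\<^sub>R v) 0" by (intro continuous_intros)
  then have "isCont ?c 0"
    by (rule isCont_o2) (use isCont_chart_inv[OF assms p] in simp)
  moreover have "((\<lambda>t. chart C p (?c t)) has_vector_derivative v) (at 0)"
  proof (rule has_vector_derivative_transform_within_open[OF _ U])
    show "((\<lambda>t. ?x + t *\<^sub>R v) has_vector_derivative v) (at 0)"
      by (auto intro!: derivative_eq_intros)
    show "?x + t *\<^sub>R v = chart C p (?c t)" if "t \<in> ?U" for t
      using that by (auto simp: chart_inv_chart[OF assms])
  qed (use p in simp)
  ultimately show "has_velocity C ?c v 0"
    unfolding has_velocity_def using c0 by simp
qed

lemma zero_velocity_imp_constant:
  assumes "smooth_manifold C" "open S" "connected S" "\<And>t. t \<in> S \<Longrightarrow> has_velocity C w 0 t"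
    and "s \<in> S" "t \<in> S"
  shows "w s = w t"
proof -
  note C = smooth_manifold_charted[OF assms(1)]
  have "w constant_on S"
  proof (rule locally_constant_imp_constant[OF assms(3)])
    fix a assume a: "a \<in> S"
    have "isCont w a" using assms(4)[OF a] by (simp add: has_velocity_def)
    then have "\<forall>\<^sub>F s in nhds a. w s \<in> chart_dom C (w a)"
      using open_chart_dom[OF C] chart_dom_self[OF C]
      by (metis isCont_def tendsto_at_iff_tendsto_nhds topological_tendstoD)
    then obtain d where d: "d > 0" "\<And>s. dist s a < d \<Longrightarrow> w s \<in> chart_dom C (w a)"
      by (auto simp: eventually_nhds_metric)
    obtain e where e: "e > 0" "ball a e \<subseteq> S" using assms(2) a open_contains_ball by blast
    let ?B = "ball a (min d e)"
    have B: "s \<in> S" "w s \<in> chart_dom C (w a)" if "s \<in> ?B" for s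
      using that d e by (auto simp: dist_commute)
    \<comment> \<open>The velocity at s is known in the chart of \<open>w s\<close>; the derivative
      of the chart change takes it to the fixed chart of \<open>w a\<close> and, being linear, sends
      0 to 0.\<close>
    have der: "((\<lambda>s. chart C (w a) (w s)) has_derivative (\<lambda>h. 0)) (at s)" if s: "s \<in> ?B" for s
    proof -
      have v: "chart_velocity C (w s) w 0 s"
        using assms(4)[OF B(1)[OF s]] has_velocity_iff[OF C] by blast
      have "linear (frechet_derivative (chart C (w a) \<circ> (\<lambda>x. x) \<circ> chart_inv C (w s)) (at (chart C (w s) (w s))))"
        using smooth_map_has_derivative[OF smooth_map_id[OF assms(1)] chart_dom_self[OF C] B(2)[OF s]]
        by (rule has_derivative_linear)
      then show ?thesis
        using chart_velocity_compose[OF C smooth_map_id[OF assms(1)] v B(2)[OF s]]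
        by (simp add: chart_velocity_def linear_0 has_vector_derivative_def)
    qed
    have "\<exists>k. \<forall>s\<in>?B. chart C (w a) (w s) = k"
      by (rule has_derivative_zero_constant[OF convex_ball has_derivative_at_withinI[OF der]])
    then obtain k where k: "\<And>s. s \<in> ?B \<Longrightarrow> chart C (w a) (w s) = k"
      by blast
    have a': "a \<in> ?B" using d(1) e(1) by simp
    have "w s = w a" if "s \<in> ?B" for s
      using k[OF that] k[OF a'] chart_inv_chart[OF C B(2)[OF that]] chart_inv_chart[OF C B(2)[OF a']]
      by metis
    moreover have "openin (top_of_set S) ?B"
      using e(2) by (intro open_subset) auto
    ultimately show "\<exists>T. openin (top_of_set S) T \<and> a \<in> T \<and> (\<forall>s\<in>T. w s = w a)"
      using a' by blast
  qed
  then show ?thesis using assms(5,6) by (metis constant_on_def)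
qed

section \<open>Functoriality and linearity of tangent maps\<close>

lemma tangent_map_compose:
  assumes "charted C" "charted D" "charted E" "smooth_map C D f" "smooth_map D E g"
  shows "tangent_map C E (\<lambda>x. g (f x)) p v = tangent_map D E g (f p) (tangent_map C D f p v)"
proof -
  obtain c where c: "c 0 = p" "has_velocity C c v 0" using has_velocity_exists[OF assms(1)] by blast
  have "has_velocity E (\<lambda>s. g (f (c s))) (tangent_map D E g (f p) (tangent_map C D f p v)) 0"
    using has_velocity_compose[OF assms(2,3,5) has_velocity_compose[OF assms(1,2,4) c(2)]] c(1) by simp
  moreover have "has_velocity E (\<lambda>s. g (f (c s))) (tangent_map C E (\<lambda>x. g (f x)) p v) 0"
    using has_velocity_compose[OF assms(1,3) smooth_map_compose[OF assms] c(2)] c(1) by simp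
  ultimately show ?thesis using has_velocity_unique by blast
qed

lemma tangent_map_id:
  assumes "smooth_manifold C"
  shows "tangent_map C C (\<lambda>x. x) p v = v"
proof -
  note C = smooth_manifold_charted[OF assms]
  obtain c where c: "c 0 = p" "has_velocity C c v 0" using has_velocity_exists[OF C] by blast
  have "has_velocity C c (tangent_map C C (\<lambda>x. x) p v) 0"
    using has_velocity_compose[OF C C smooth_map_id[OF assms] c(2)] c(1) by simp
  with c(2) show ?thesis using has_velocity_unique by blast
qed

lemma linear_tangent_map:
  assumes "charted C" "charted D" "smooth_map C D f"
  shows "bounded_linear (tangent_map C D f p)"
  unfolding tangent_map_def
  by (rule has_derivative_bounded_linear[OF smooth_map_has_derivative])
     (use assms chart_dom_self in auto)

section \<open>One-parameter subgroups\<close>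

lemma has_velocity_shift:
  fixes C :: "('m::topological_space, 'b::real_normed_vector) atlas"
  shows "has_velocity C (\<lambda>h. c (t + h)) v 0 \<longleftrightarrow> has_velocity C c v t"
proof -
  have "isCont (\<lambda>h. c (t + h)) 0 \<longleftrightarrow> isCont c t"
    unfolding isCont_def using LIM_offset_zero_iff[of t c "c t"] by simp
  moreover have der: "((\<lambda>h. f (t + h)) has_vector_derivative v) (at 0) \<longleftrightarrow> (f has_vector_derivative v) (at t)"
    for f :: "real \<Rightarrow> 'b"
  proof
    assume l: "((\<lambda>h. f (t + h)) has_vector_derivative v) (at 0)"
    have "((\<lambda>s. s - t) has_vector_derivative 1) (at t)"
      by (auto intro!: derivative_eq_intros)
    from vector_diff_chain_at[OF this, of "\<lambda>h. f (t + h)" v] l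
    show "(f has_vector_derivative v) (at t)" by (simp add: o_def)
  next
    assume r: "(f has_vector_derivative v) (at t)"
    have "((\<lambda>h. t + h) has_vector_derivative 1) (at 0)"
      by (auto intro!: derivative_eq_intros)
    from vector_diff_chain_at[OF this, of f v] r
    show "((\<lambda>h. f (t + h)) has_vector_derivative v) (at 0)" by (simp add: o_def)
  qed
  ultimately show ?thesis
    using der[of "\<lambda>s. chart C (c t) (c s)"] by (simp add: has_velocity_def)
qed

lemma has_velocity_transform:
  assumes "has_velocity C c v t" "open U" "t \<in> U" "\<And>s. s \<in> U \<Longrightarrow> c s = d s"
  shows "has_velocity C d v t"
proof -
  have "\<forall>\<^sub>F s in nhds t. c s = d s"
    using assms(2-4) eventually_nhds by blast
  then have "isCont d t"
    using assms(1) isCont_cong[of c d t] by (simp add: has_velocity_def)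
  moreover have "((\<lambda>s. chart C (d t) (d s)) has_vector_derivative v) (at t)"
    using assms has_vector_derivative_transform_within_open[of "\<lambda>s. chart C (c t) (c s)" v t U]
    by (simp add: has_velocity_def)
  ultimately show ?thesis by (simp add: has_velocity_def)
qed

lemma chart_velocity_const: "p \<in> chart_dom C q \<Longrightarrow> chart_velocity C q (\<lambda>_. p) 0 t"
  by (simp add: chart_velocity_def)

lemma has_velocity_const: "has_velocity C (\<lambda>_. p) 0 t"
  by (simp add: has_velocity_def)

section \<open>Quotients of curves and uniqueness of one-parameter subgroups\<close>

locale lie_group_atlas =
  fixes G :: "'g::{t2_space, second_countable_topology} monoid" (structure)
    and C :: "('g, 'a::banach) atlas"
  assumes lie_group: "lie_group G C"
begin

sublocale group G
  using lie_group by (simp add: lie_group_def)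

lemma carrier_UNIV [simp]: "carrier G = UNIV"
  using lie_group by (simp add: lie_group_def)

lemma inv_mult_cancel: "inv x \<otimes> (x \<otimes> y) = y"
  by (simp add: m_assoc[symmetric])

lemma manifold: "smooth_manifold C"
  using lie_group by (simp add: lie_group_def)

lemma charted: "charted C"
  using manifold by (rule smooth_manifold_charted)

lemma finite_dim: "finite_dim TYPE('a)"
  using charted by (rule charted_finite_dim)

lemma charted2: "charted (prod_atlas C C)"
  by (intro charted_prod_atlas charted)

lemma smooth_mult: "smooth_map (prod_atlas C C) C (\<lambda>(x, y). x \<otimes> y)"
  using lie_group by (simp add: lie_group_def)

lemma smooth_map_mult:
  assumes "charted A" "smooth_map A C f" "smooth_map A C g"
  shows "smooth_map A C (\<lambda>x. f x \<otimes> g x)"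
  using smooth_map_compose[OF assms(1) charted2 charted
      smooth_map_Pair[OF assms(1) charted charted assms(2,3)] smooth_mult] by simp

lemma smooth_map_inv:
  assumes "charted A" "smooth_map A C f"
  shows "smooth_map A C (\<lambda>x. inv (f x))"
  using smooth_map_compose[OF assms(1) charted charted assms(2)] lie_group by (simp add: lie_group_def)

lemmas smooth_intros = smooth_map_mult smooth_map_inv smooth_map_const smooth_map_id
  smooth_map_fst smooth_map_snd charted charted2 manifold

text \<open>The right logarithmic derivative. Translation by the inverse of \<alpha> t puts all
  velocities into the tangent space at the identity, where their coordinates are comparable.\<close>

definition log_velocity :: "(real \<Rightarrow> 'g) \<Rightarrow> 'a \<Rightarrow> real \<Rightarrow> bool" where
  "log_velocity \<alpha> \<xi> t \<longleftrightarrow> has_velocity C (\<lambda>h. \<alpha> (t + h) \<otimes> inv (\<alpha> t)) \<xi> 0"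

text \<open>The derivative of the quotient map is not computed. It kills (\<xi>, \<xi>) because the
  pair (a, a) has this velocity too, and its quotient is constant.\<close>

lemma has_velocity_quotient:
  assumes "has_velocity C a \<xi> 0" "has_velocity C b \<xi> 0" "a 0 = \<one>" "b 0 = \<one>"
  shows "has_velocity C (\<lambda>h. inv (a h) \<otimes> b h) 0 0"
proof -
  let ?Q = "\<lambda>z. inv (fst z) \<otimes> snd z"
  have Q: "smooth_map (prod_atlas C C) C ?Q"
    by (intro smooth_intros)
  have *: "has_velocity C (\<lambda>h. inv (a h) \<otimes> d h) (tangent_map (prod_atlas C C) C ?Q (\<one>, \<one>) (\<xi>, \<xi>)) 0"
    if "has_velocity C d \<xi> 0" "d 0 = \<one>" for d
    using has_velocity_compose[OF charted2 charted Q, of "\<lambda>h. (a h, d h)" "(\<xi>, \<xi>)" 0] assms(1,3) that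
    by (simp add: has_velocity_Pair charted)
  have "tangent_map (prod_atlas C C) C ?Q (\<one>, \<one>) (\<xi>, \<xi>) = 0"
    using *[OF assms(1,3)] has_velocity_const[of C \<one> 0] has_velocity_unique by (simp add: l_inv)
  with *[OF assms(2,4)] show ?thesis by simp
qed

lemma log_velocity_quotient_constant:
  assumes "open S" "connected S"
    and \<alpha>: "\<And>t. t \<in> S \<Longrightarrow> log_velocity \<alpha> \<xi> t" and \<beta>: "\<And>t. t \<in> S \<Longrightarrow> log_velocity \<beta> \<xi> t"
    and "s \<in> S" "t \<in> S"
  shows "inv (\<alpha> s) \<otimes> \<beta> s = inv (\<alpha> t) \<otimes> \<beta> t"
proof (rule zero_velocity_imp_constant[OF manifold assms(1,2) _ assms(5,6)])
  fix t assume t: "t \<in> S"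
  let ?a = "\<lambda>h. \<alpha> (t + h) \<otimes> inv (\<alpha> t)" and ?b = "\<lambda>h. \<beta> (t + h) \<otimes> inv (\<beta> t)"
  \<comment> \<open>The quotient of \<alpha> and \<beta> at t + h is the quotient of the translated
    curves between two factors that do not depend on h; the tangent map of this sandwich preserves
    zero velocity.\<close>
  let ?f = "\<lambda>x. inv (\<alpha> t) \<otimes> x \<otimes> \<beta> t"
  have f: "smooth_map C C ?f" by (intro smooth_intros)
  have "has_velocity C (\<lambda>h. inv (?a h) \<otimes> ?b h) 0 0"
    using \<alpha>[OF t] \<beta>[OF t] by (intro has_velocity_quotient) (auto simp: log_velocity_def)
  from has_velocity_compose[OF charted charted f this]
  have "has_velocity C (\<lambda>h. ?f (inv (?a h) \<otimes> ?b h)) 0 0"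
    using linear_tangent_map[OF charted charted f] by (simp add: linear_simps)
  moreover have "?f (inv (?a h) \<otimes> ?b h) = inv (\<alpha> (t + h)) \<otimes> \<beta> (t + h)" for h
    by (simp add: inv_mult_group m_assoc inv_mult_cancel)
  ultimately have "has_velocity C (\<lambda>h. inv (\<alpha> (t + h)) \<otimes> \<beta> (t + h)) 0 0" by simp
  then show "has_velocity C (\<lambda>t. inv (\<alpha> t) \<otimes> \<beta> t) 0 t"
    using has_velocity_shift[of C "\<lambda>t. inv (\<alpha> t) \<otimes> \<beta> t"] by simp
qed

lemma one_parameter_subgroup_zero: "one_parameter_subgroup G C \<xi> c \<Longrightarrow> c 0 = \<one>"
  unfolding one_parameter_subgroup_def
  by (metis UNIV_I add_0 carrier_UNIV l_cancel_one')

lemma one_parameter_subgroup_log_velocity: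
  assumes "one_parameter_subgroup G C \<xi> c"
  shows "log_velocity c \<xi> t"
proof -
  have c: "c (s + t) = c s \<otimes> c t" for s t
    using assms by (simp add: one_parameter_subgroup_def)
  have "c (t + h) \<otimes> inv (c t) = c h" for h
    using c[of h t] by (simp add: m_assoc add.commute)
  then show ?thesis
    using assms by (simp add: log_velocity_def one_parameter_subgroup_def)
qed

lemma one_parameter_subgroup_unique:
  assumes "one_parameter_subgroup G C \<xi> c" "one_parameter_subgroup G C \<xi> d"
  shows "c = d"
proof
  fix t
  have "inv (c t) \<otimes> d t = inv (c 0) \<otimes> d 0"
    by (rule log_velocity_quotient_constant[of UNIV])
       (use assms one_parameter_subgroup_log_velocity in auto)
  then have "inv (c t) \<otimes> d t = \<one>"
    using assms[THEN one_parameter_subgroup_zero] by simp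
  then show "c t = d t" by (metis UNIV_I carrier_UNIV inv_equality inv_inv)
qed

text \<open>In the chart at \<open>\<one>\<close>, a curve with logarithmic velocity \<open>\<xi>\<close> is a solution of the
  autonomous equation given by the right invariant vector field of \<open>\<xi>\<close>.\<close>

lemma log_velocity_local_solution:
  obtains \<epsilon> c where "\<epsilon> > 0" "c 0 = chart C \<one> \<one>" "smooth_on {-\<epsilon><..<\<epsilon>} c"
    "\<And>t. t \<in> {-\<epsilon><..<\<epsilon>} \<Longrightarrow> c t \<in> chart C \<one> ` chart_dom C \<one>"
    "\<And>t. t \<in> {-\<epsilon><..<\<epsilon>} \<Longrightarrow> log_velocity (\<lambda>t. chart_inv C \<one> (c t)) \<xi> t"
proof -
  let ?m = "\<lambda>(x, y). x \<otimes> y"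
  define F where "F = chart C \<one> \<circ> ?m \<circ> chart_inv (prod_atlas C C) (\<one>, \<one>)"
  define W where "W = chart (prod_atlas C C) (\<one>, \<one>) `
    (chart_dom (prod_atlas C C) (\<one>, \<one>) \<inter> ?m -` chart_dom C \<one>)"
  define x0 where "x0 = chart C \<one> \<one>"
  define R where "R = chart C \<one> ` chart_dom C \<one>"
  \<comment> \<open>The right invariant field of \<xi> in coordinates: the derivative of
    multiplication in its first factor at the identity.\<close>
  define f where "f = (\<lambda>y. frechet_derivative F (at (x0, y)) (\<xi>, 0))"
  have one: "\<one> \<in> chart_dom C \<one>" by (rule chart_dom_self[OF charted])
  have oW: "open W"
    unfolding W_def
    by (intro open_smooth_map_domain charted2 charted smooth_map_continuous[OF smooth_mult])
  have oR: "open R" unfolding R_def by (rule open_chart_range[OF charted])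
  have RW: "(x0, y) \<in> W" if "y \<in> R" for y
  proof -
    from that obtain g where "g \<in> chart_dom C \<one>" "y = chart C \<one> g" unfolding R_def by blast
    then show ?thesis
      unfolding W_def x0_def using one by (intro image_eqI[of _ _ "(\<one>, g)"]) auto
  qed
  have "Ck_on n R f" for n
  proof -
    have "Ck_on (Suc n) W F"
      unfolding W_def F_def by (rule smooth_map_Ck[OF smooth_mult])
    then have Ck: "Ck_on n W (\<lambda>z. frechet_derivative F (at z) (\<xi>, 0))" by simp
    have emb: "Ck_on n R (\<lambda>y. (x0, y))"
      using oR by (intro Ck_on_Pair Ck_on_const Ck_on_bounded_linear bounded_linear_ident)
    show ?thesis
      unfolding f_def
      by (rule Ck_on_compose[OF finite_dim_prod[OF finite_dim finite_dim] oR oW _ Ck emb])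
         (use RW in auto)
  qed
  then have "smooth_on R f" by (simp add: smooth_on_def)
  moreover have "x0 \<in> R" using one by (simp add: x0_def R_def)
  ultimately obtain \<epsilon> c where \<epsilon>: "\<epsilon> > 0" and c0: "c 0 = x0" and sc: "smooth_on {-\<epsilon><..<\<epsilon>} c"
    and cR: "\<And>t. t \<in> {-\<epsilon><..<\<epsilon>} \<Longrightarrow> c t \<in> R"
    and c': "\<And>t. t \<in> {-\<epsilon><..<\<epsilon>} \<Longrightarrow> (c has_vector_derivative f (c t)) (at t)"
    by (rule smooth_ode_local_solution[OF finite_dim oR]) blast
  define \<gamma> where "\<gamma> = (\<lambda>t. chart_inv C \<one> (c t))"
  have \<gamma>: "\<gamma> t \<in> chart_dom C \<one>" "chart C \<one> (\<gamma> t) = c t" if "t \<in> {-\<epsilon><..<\<epsilon>}" for t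
    using cR[OF that] chart_inv_chart[OF charted] by (auto simp: R_def \<gamma>_def)
  have "log_velocity \<gamma> \<xi> t" if t: "t \<in> {-\<epsilon><..<\<epsilon>}" for t
  proof -
    let ?f = "\<lambda>x. x \<otimes> inv (\<gamma> t)"
    have f: "smooth_map C C ?f" by (intro smooth_intros)
    obtain \<sigma> where \<sigma>: "\<sigma> 0 = \<one>" "has_velocity C \<sigma> \<xi> 0"
      using has_velocity_exists[OF charted] by blast
    have v1: "chart_velocity C \<one> (\<lambda>h. \<gamma> (t + h)) (f (c t)) 0"
      unfolding chart_velocity_def
    proof (intro conjI)
      have "isCont c t" using c'[OF t] by (rule has_vector_derivative_continuous)
      moreover have "isCont (chart_inv C \<one>) (c t)"
        using isCont_chart_inv[OF charted \<gamma>(1)[OF t]] \<gamma>(2)[OF t] by simp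
      ultimately have "isCont \<gamma> t" unfolding \<gamma>_def by (rule isCont_o2)
      then show "isCont (\<lambda>h. \<gamma> (t + h)) 0"
        unfolding isCont_def using LIM_offset_zero_iff[of t \<gamma> "\<gamma> t"] by simp
      show "\<gamma> (t + 0) \<in> chart_dom C \<one>" using \<gamma>(1)[OF t] by simp
      have "((\<lambda>h. t + h) has_vector_derivative 1) (at 0)"
        by (auto intro!: derivative_eq_intros)
      from vector_diff_chain_at[OF this, of c "f (c t)"] c'[OF t]
      have d: "((\<lambda>h. c (t + h)) has_vector_derivative f (c t)) (at 0)" by (simp add: o_def)
      show "((\<lambda>h. chart C \<one> (\<gamma> (t + h))) has_vector_derivative f (c t)) (at 0)"
        by (rule has_vector_derivative_transform_within_open[OF d, of "{-\<epsilon>-t<..<\<epsilon>-t}"])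
           (use t \<gamma>(2) in auto)
    qed
    have \<sigma>': "chart_velocity C \<one> \<sigma> \<xi> 0" using \<sigma> has_velocity_iff[OF charted] by metis
    have "chart_velocity (prod_atlas C C) (\<one>, \<one>) (\<lambda>h. (\<sigma> h, \<gamma> t)) (\<xi>, 0) 0"
      using \<sigma>' chart_velocity_const[OF \<gamma>(1)[OF t]] by (simp add: chart_velocity_Pair)
    from chart_velocity_compose[OF charted2 smooth_mult this, of \<one>]
    have v2: "chart_velocity C \<one> (\<lambda>h. \<sigma> h \<otimes> \<gamma> t) (f (c t)) 0"
      using \<sigma>(1) \<gamma>[OF t] by (simp add: f_def F_def x0_def)
    \<comment> \<open>By the equation, \<open>\<gamma> (t + h)\<close> and
      \<open>\<sigma> h \<otimes> \<gamma> t\<close> have the same velocity at h = 0. Translation by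
      \<open>inv (\<gamma> t)\<close> turns both velocities into u and the second curve into
      \<sigma>, so u = \<xi>.\<close>
    define u where "u = frechet_derivative (chart C \<one> \<circ> ?f \<circ> chart_inv C \<one>) (at (c t)) (f (c t))"
    have "chart_velocity C \<one> (\<lambda>h. \<gamma> (t + h) \<otimes> inv (\<gamma> t)) u 0"
      using chart_velocity_compose[OF charted f v1, of \<one>] \<gamma>[OF t] one by (simp add: u_def)
    moreover have "chart_velocity C \<one> \<sigma> u 0"
      using chart_velocity_compose[OF charted f v2, of \<one>] \<gamma>[OF t] one \<sigma>(1)
      by (simp add: u_def m_assoc)
    ultimately have "chart_velocity C \<one> (\<lambda>h. \<gamma> (t + h) \<otimes> inv (\<gamma> t)) \<xi> 0"
      using \<sigma>' chart_velocity_unique by blast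
    then show ?thesis by (simp add: log_velocity_def has_velocity_iff[OF charted])
  qed
  then show ?thesis
    using that[OF \<epsilon> _ sc] c0 cR by (simp add: x0_def R_def \<gamma>_def)
qed

section \<open>Extension of the local solution to a homomorphism on the line\<close>

lemma log_velocity_local_homomorphism:
  assumes "\<And>t. \<bar>t\<bar> < \<epsilon> \<Longrightarrow> log_velocity \<gamma> \<xi> t" "\<gamma> 0 = \<one>"
    and "\<bar>s\<bar> < \<epsilon>" "\<bar>t\<bar> < \<epsilon>" "\<bar>s + t\<bar> < \<epsilon>"
  shows "\<gamma> (s + t) = \<gamma> s \<otimes> \<gamma> t"
proof -
  \<comment> \<open>The s for which s and s + t both lie in the domain. This is an interval
    containing 0, where the quotient of the two curves equals \<gamma> t.\<close>
  let ?J = "{-\<epsilon><..<\<epsilon>} \<inter> {-\<epsilon>-t<..<\<epsilon>-t}"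
  have "connected ?J"
    by (intro convex_connected convex_Int convex_real_interval)
  have "log_velocity (\<lambda>s. \<gamma> (s + t)) \<xi> s" if "s \<in> ?J" for s
    using assms(1)[of "s + t"] that by (simp add: log_velocity_def abs_less_iff add_ac)
  then have "inv (\<gamma> s) \<otimes> \<gamma> (s + t) = inv (\<gamma> 0) \<otimes> \<gamma> (0 + t)"
    using assms \<open>connected ?J\<close>
    by (intro log_velocity_quotient_constant[of ?J \<gamma> \<xi> "\<lambda>s. \<gamma> (s + t)"])
       (auto simp: abs_less_iff open_Int)
  then have *: "inv (\<gamma> s) \<otimes> \<gamma> (s + t) = \<gamma> t" by (simp add: assms(2))
  show ?thesis by (subst *[symmetric]) (simp add: m_assoc[symmetric])
qed

text \<open>Purely algebraic. \<Gamma> t is the n-th power of \<open>\<gamma> (t / n)\<close> for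
  any sufficiently large n; two choices n and m agree since both powers are the same power of
  \<gamma> at t divided by the product of n and m.\<close>

lemma local_homomorphism_extends:
  assumes "\<epsilon> > 0" "\<gamma> 0 = \<one>"
    and hom: "\<And>s t. \<bar>s\<bar> < \<epsilon> \<Longrightarrow> \<bar>t\<bar> < \<epsilon> \<Longrightarrow> \<bar>s + t\<bar> < \<epsilon> \<Longrightarrow> \<gamma> (s + t) = \<gamma> s \<otimes> \<gamma> t"
  obtains \<Gamma> where "\<And>s t. \<Gamma> (s + t) = \<Gamma> s \<otimes> \<Gamma> t" "\<And>t::real. \<bar>t\<bar> < \<epsilon> \<Longrightarrow> \<Gamma> t = \<gamma> t"
proof -
  have pow: "\<gamma> (real n * s) = \<gamma> s [^] n" if "\<bar>real n * s\<bar> < \<epsilon>" for n s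
    using that
  proof (induction n)
    case 0
    then show ?case by (simp add: assms(2))
  next
    case (Suc n)
    have le: "\<bar>real n * s\<bar> \<le> \<bar>real (Suc n) * s\<bar>" "\<bar>s\<bar> \<le> \<bar>real (Suc n) * s\<bar>"
      by (auto simp: abs_mult intro: mult_right_mono mult_left_mono
          mult_le_cancel_right1[THEN iffD2])
    have "\<gamma> (real n * s + s) = \<gamma> (real n * s) \<otimes> \<gamma> s"
      using le Suc.prems by (intro hom) (auto simp: algebra_simps)
    then show ?case using Suc.IH le(1) Suc.prems by (simp add: algebra_simps)
  qed
  have indep: "\<gamma> (t / real n) [^] n = \<gamma> (t / real m) [^] m"
    if "n > 0" "m > 0" "\<bar>t / real n\<bar> < \<epsilon>" "\<bar>t / real m\<bar> < \<epsilon>" for t n m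
  proof -
    let ?s = "t / (real n * real m)"
    have s: "real m * ?s = t / real n" "real n * ?s = t / real m"
      using that by (auto simp: field_simps)
    have "\<gamma> (t / real n) [^] n = \<gamma> ?s [^] (m * n)"
      using pow[of m ?s] s that(3) by (simp add: nat_pow_pow)
    moreover have "\<gamma> (t / real m) [^] m = \<gamma> ?s [^] (n * m)"
      using pow[of n ?s] s that(4) by (simp add: nat_pow_pow)
    ultimately show ?thesis by (simp add: mult.commute)
  qed
  \<comment> \<open>\<open>Suc\<close> secures both positivity and the strict inequality
    \<open>\<bar>t\<bar> / \<epsilon> < N t\<close>.\<close>
  define N where "N = (\<lambda>t. Suc (nat \<lceil>\<bar>t\<bar> / \<epsilon>\<rceil>))"
  have N: "N t > 0" "\<bar>t / real (N t)\<bar> < \<epsilon>" for t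
  proof -
    show "N t > 0" by (simp add: N_def)
    have "\<bar>t\<bar> / \<epsilon> \<le> real (nat \<lceil>\<bar>t\<bar> / \<epsilon>\<rceil>)" by (rule real_nat_ceiling_ge)
    then have "\<bar>t\<bar> / \<epsilon> < real (N t)" by (simp add: N_def)
    then show "\<bar>t / real (N t)\<bar> < \<epsilon>"
      using assms(1) \<open>N t > 0\<close> by (simp add: field_simps)
  qed
  define \<Gamma> where "\<Gamma> = (\<lambda>t. \<gamma> (t / real (N t)) [^] N t)"
  have \<Gamma>: "\<Gamma> t = \<gamma> (t / real n) [^] n" if "n > 0" "\<bar>t / real n\<bar> < \<epsilon>" for t n
    unfolding \<Gamma>_def by (rule indep) (use that N in auto)
  show ?thesis
  proof (rule that)
    show "\<Gamma> t = \<gamma> t" if "\<bar>t\<bar> < \<epsilon>" for t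
      using \<Gamma>[of 1 t] that by simp
    fix s t
    \<comment> \<open>One n that serves s, t and s + t, all bounded in absolute value by this
      sum.\<close>
    let ?n = "N (\<bar>s\<bar> + \<bar>t\<bar>)"
    have n: "?n > 0" "(\<bar>s\<bar> + \<bar>t\<bar>) / real ?n < \<epsilon>"
      using N[of "\<bar>s\<bar> + \<bar>t\<bar>"] by auto
    have b: "\<bar>r / real ?n\<bar> < \<epsilon>" if "\<bar>r\<bar> \<le> \<bar>s\<bar> + \<bar>t\<bar>" for r
      using divide_right_mono[OF that, of "real ?n"] n by simp
    have bs: "\<bar>s / real ?n\<bar> < \<epsilon>" "\<bar>t / real ?n\<bar> < \<epsilon>" "\<bar>(s + t) / real ?n\<bar> < \<epsilon>"
      by (intro b; simp)+
    have st: "\<gamma> (s / real ?n + t / real ?n) = \<gamma> (s / real ?n) \<otimes> \<gamma> (t / real ?n)"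
      using bs by (intro hom) (auto simp: add_divide_distrib)
    \<comment> \<open>Splitting the power of a product requires commuting factors; they commute
      because s + t = t + s.\<close>
    have ts: "\<gamma> (t / real ?n + s / real ?n) = \<gamma> (t / real ?n) \<otimes> \<gamma> (s / real ?n)"
      using bs by (intro hom) (auto simp: add_divide_distrib add.commute)
    have comm: "\<gamma> (s / real ?n) \<otimes> \<gamma> (t / real ?n) = \<gamma> (t / real ?n) \<otimes> \<gamma> (s / real ?n)"
      using st ts by (simp add: add.commute)
    have "\<gamma> ((s + t) / real ?n) [^] ?n = \<gamma> (s / real ?n) [^] ?n \<otimes> \<gamma> (t / real ?n) [^] ?n"
      unfolding add_divide_distrib st by (rule pow_mult_distrib[OF comm]) simp_all
    then show "\<Gamma> (s + t) = \<Gamma> s \<otimes> \<Gamma> t"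
      using \<Gamma>[OF n(1)] bs by simp
  qed
qed

text \<open>Near r, \<Gamma> is the local curve shifted to r, followed by left translation by
  \<Gamma> r, so smoothness near 0 spreads along the line. Continuity is settled beforehand because
  it makes the preimages of chart domains open.\<close>

lemma smooth_homomorphism:
  assumes "\<epsilon> > 0" "smooth_on {-\<epsilon><..<\<epsilon>} c"
    and cR: "\<And>t. \<bar>t\<bar> < \<epsilon> \<Longrightarrow> c t \<in> chart C \<one> ` chart_dom C \<one>"
    and hom: "\<And>s t. \<Gamma> (s + t) = \<Gamma> s \<otimes> \<Gamma> t"
    and loc: "\<And>t::real. \<bar>t\<bar> < \<epsilon> \<Longrightarrow> \<Gamma> t = chart_inv C \<one> (c t)"
  shows "smooth_map vector_atlas C \<Gamma>"
proof -
  have c: "\<Gamma> t \<in> chart_dom C \<one>" "chart C \<one> (\<Gamma> t) = c t" if "\<bar>t\<bar> < \<epsilon>" for t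
    using cR[OF that] loc[OF that] chart_inv_chart[OF charted] by auto
  have tr: "\<Gamma> t = \<Gamma> r \<otimes> chart_inv C \<one> (c (t - r))" if "\<bar>t - r\<bar> < \<epsilon>" for t r
    using hom[of r "t - r"] loc[OF that] by simp
  have L: "smooth_map C C (\<lambda>x. \<Gamma> r \<otimes> x)" for r
    by (intro smooth_intros)
  have Ckc: "Ck_on n (ball r \<epsilon>) (\<lambda>t. c (t - r))" for r n
  proof (rule Ck_on_compose[where g = "\<lambda>t. t - r" and T = "{-\<epsilon><..<\<epsilon>}", OF finite_dim_real])
    show "Ck_on n (ball r \<epsilon>) (\<lambda>t. t - r)"
      using Ck_on_add[OF open_ball Ck_on_bounded_linear[OF open_ball bounded_linear_ident]
          Ck_on_const[OF open_ball, of n _ _ "- r"]] by simp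
    show "Ck_on n {-\<epsilon><..<\<epsilon>} c" using assms(2) by (simp add: smooth_on_def)
  qed (auto simp: dist_real_def)
  have cont: "continuous_on UNIV \<Gamma>"
  proof (rule continuous_at_imp_continuous_on, clarify)
    fix r
    have "isCont (\<lambda>t. c (t - r)) r"
      using Ckc[of 0 r] assms(1) by (simp add: continuous_on_eq_continuous_at)
    moreover have "isCont (chart_inv C \<one>) (c (r - r))"
      using isCont_chart_inv[OF charted c(1)[of 0]] c(2)[of 0] assms(1) by simp
    ultimately have "isCont (\<lambda>t. chart_inv C \<one> (c (t - r))) r"
      by (rule isCont_o2)
    moreover have "isCont (\<lambda>x. \<Gamma> r \<otimes> x) x" for x
      using smooth_map_continuous[OF L] continuous_on_eq_continuous_at by blast
    ultimately have "isCont (\<lambda>t. \<Gamma> r \<otimes> chart_inv C \<one> (c (t - r))) r"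
      by (rule isCont_o2)
    moreover have "\<forall>\<^sub>F t in nhds r. \<Gamma> r \<otimes> chart_inv C \<one> (c (t - r)) = \<Gamma> t"
      using tr assms(1) unfolding eventually_nhds_metric dist_real_def by metis
    ultimately show "isCont \<Gamma> r"
      using isCont_cong[of "\<lambda>t. \<Gamma> r \<otimes> chart_inv C \<one> (c (t - r))" \<Gamma> r] by blast
  qed
  have "Ck_on n (\<Gamma> -` chart_dom C q) (chart C q \<circ> \<Gamma>)" for n q
  proof (rule Ck_on_local)
    fix r assume r: "r \<in> \<Gamma> -` chart_dom C q"
    let ?S = "ball r \<epsilon> \<inter> \<Gamma> -` chart_dom C q"
    let ?T = "chart C \<one> ` (chart_dom C \<one> \<inter> (\<lambda>x. \<Gamma> r \<otimes> x) -` chart_dom C q)"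
    let ?h = "chart C q \<circ> (\<lambda>x. \<Gamma> r \<otimes> x) \<circ> chart_inv C \<one>"
    have oS: "open ?S" by (intro open_Int open_ball open_vimage cont open_chart_dom charted)
    have oT: "open ?T" by (intro open_smooth_map_domain charted smooth_map_continuous[OF L])
    have S: "\<bar>t - r\<bar> < \<epsilon>" "\<Gamma> t \<in> chart_dom C q" if "t \<in> ?S" for t
      using that by (auto simp: dist_real_def)
    have "Ck_on n ?S (\<lambda>t. ?h (c (t - r)))"
    proof (rule Ck_on_compose[where g = "\<lambda>t. c (t - r)" and T = ?T, OF finite_dim oS oT])
      show "(\<lambda>t. c (t - r)) ` ?S \<subseteq> ?T"
      proof clarify
        fix t assume "t \<in> ball r \<epsilon>" "\<Gamma> t \<in> chart_dom C q"
        then have "t \<in> ?S" by simp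
        note t = S[OF this]
        show "c (t - r) \<in> ?T"
          using c[OF t(1)] tr[OF t(1)] t(2) loc[OF t(1)]
          by (intro image_eqI[of _ _ "\<Gamma> (t - r)"]) auto
      qed
      show "Ck_on n ?T ?h" by (rule smooth_map_Ck[OF L])
      show "Ck_on n ?S (\<lambda>t. c (t - r))" by (rule Ck_on_subset[OF Ckc]) auto
    qed
    moreover have "?h (c (t - r)) = (chart C q \<circ> \<Gamma>) t" if "t \<in> ?S" for t
      using tr[OF S(1)[OF that]] by simp
    ultimately have "Ck_on n ?S (chart C q \<circ> \<Gamma>)"
      by (rule Ck_on_transform[OF oS])
    then show "\<exists>T. open T \<and> r \<in> T \<and> Ck_on n T (chart C q \<circ> \<Gamma>)"
      using oS r assms(1) by (intro exI[of _ ?S]) auto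
  qed
  with cont show ?thesis by (simp add: smooth_map_def smooth_on_def)
qed

lemma one_parameter_subgroup_exists: "\<exists>c. one_parameter_subgroup G C \<xi> c"
proof -
  obtain \<epsilon> c where \<epsilon>: "\<epsilon> > 0" and c0: "c 0 = chart C \<one> \<one>" and sc: "smooth_on {-\<epsilon><..<\<epsilon>} c"
    and cR: "\<And>t. t \<in> {-\<epsilon><..<\<epsilon>} \<Longrightarrow> c t \<in> chart C \<one> ` chart_dom C \<one>"
    and lv: "\<And>t. t \<in> {-\<epsilon><..<\<epsilon>} \<Longrightarrow> log_velocity (\<lambda>t. chart_inv C \<one> (c t)) \<xi> t"
    using log_velocity_local_solution[of \<xi>] by blast
  define \<gamma> where "\<gamma> = (\<lambda>t. chart_inv C \<one> (c t))"
  have \<gamma>0: "\<gamma> 0 = \<one>"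
    using c0 chart_inv_chart[OF charted chart_dom_self[OF charted]] by (simp add: \<gamma>_def)
  have lv': "log_velocity \<gamma> \<xi> t" if "\<bar>t\<bar> < \<epsilon>" for t
    using lv[of t] that by (simp add: \<gamma>_def abs_less_iff)
  have "\<gamma> (s + t) = \<gamma> s \<otimes> \<gamma> t" if "\<bar>s\<bar> < \<epsilon>" "\<bar>t\<bar> < \<epsilon>" "\<bar>s + t\<bar> < \<epsilon>" for s t
    using log_velocity_local_homomorphism[of \<epsilon> \<gamma> \<xi>, OF lv' \<gamma>0 that] .
  then obtain \<Gamma> where hom: "\<And>s t. \<Gamma> (s + t) = \<Gamma> s \<otimes> \<Gamma> t" and loc: "\<And>t. \<bar>t\<bar> < \<epsilon> \<Longrightarrow> \<Gamma> t = \<gamma> t"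
    using local_homomorphism_extends[where \<epsilon> = \<epsilon> and \<gamma> = \<gamma>, OF \<epsilon> \<gamma>0] by blast
  have "smooth_map vector_atlas C \<Gamma>"
    by (rule smooth_homomorphism[OF \<epsilon> sc _ hom]) (use cR loc in \<open>auto simp: \<gamma>_def abs_less_iff\<close>)
  moreover have "has_velocity C \<Gamma> \<xi> 0"
  proof (rule has_velocity_transform[of C \<gamma> \<xi> 0 "{-\<epsilon><..<\<epsilon>}"])
    show "has_velocity C \<gamma> \<xi> 0" using lv'[of 0] \<epsilon> \<gamma>0 by (simp add: log_velocity_def)
  qed (use \<epsilon> loc in \<open>auto simp: abs_less_iff\<close>)
  ultimately show ?thesis using hom unfolding one_parameter_subgroup_def by blast
qed

section \<open>Rescaling and the exponential map\<close>

lemma one_parameter_subgroup_scale: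
  assumes "one_parameter_subgroup G C \<xi> c"
  shows "one_parameter_subgroup G C (t *\<^sub>R \<xi>) (\<lambda>s. c (t * s))"
proof -
  have c: "smooth_map vector_atlas C c" "\<And>s t. c (s + t) = c s \<otimes> c t" "has_velocity C c \<xi> 0"
    using assms by (auto simp: one_parameter_subgroup_def)
  have V: "charted (vector_atlas :: (real, real) atlas)"
    by (rule charted_vector_atlas[OF finite_dim_real])
  have m: "smooth_map (vector_atlas :: (real, real) atlas) vector_atlas (\<lambda>s. t * s)"
    by (auto simp: smooth_map_def smooth_on_def o_def intro!: continuous_intros Ck_on_bounded_linear
        bounded_linear_mult_right)
  \<comment> \<open>This velocity is the tangent map of c at 0 applied to r: it is linear in r and
    equals \<xi> at r = 1.\<close>
  have *: "has_velocity C (\<lambda>s. c (r * s)) (tangent_map vector_atlas C c 0 r) 0" for r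
  proof -
    have "((\<lambda>s. r * s) has_vector_derivative r) (at 0)"
      unfolding has_real_derivative_iff_has_vector_derivative[symmetric]
      by (auto intro!: derivative_eq_intros)
    then show ?thesis
      using has_velocity_compose[OF V charted c(1), of "\<lambda>s. r * s" r 0]
      by (simp add: has_velocity_vector_atlas)
  qed
  have "tangent_map vector_atlas C c 0 1 = \<xi>"
    using *[of 1] c(3) has_velocity_unique by simp
  then have "tangent_map vector_atlas C c 0 t = t *\<^sub>R \<xi>"
    using linear_scale[OF bounded_linear.linear[OF linear_tangent_map[OF V charted c(1)]], of 0 t 1]
    by simp
  then show ?thesis
    unfolding one_parameter_subgroup_def
    using smooth_map_compose[OF V V charted m c(1)] c(2) *[of t] by (simp add: distrib_left)
qed

text \<open>Uniqueness resolves the definite description, so the curve that \<open>ad\<close>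
  differentiates along is the one-parameter subgroup itself.\<close>

lemma lie_exp_scaleR:
  assumes "one_parameter_subgroup G C \<xi> c"
  shows "lie_exp G C (t *\<^sub>R \<xi>) = c t"
proof -
  have "(THE d. one_parameter_subgroup G C (t *\<^sub>R \<xi>) d) = (\<lambda>s. c (t * s))"
    using one_parameter_subgroup_scale[OF assms] one_parameter_subgroup_unique by blast
  then show ?thesis by (simp add: lie_exp_def)
qed

end

section \<open>The Lie bracket\<close>

context lie_group_atlas
begin

text \<open>Coordinate expression of the conjugation \<open>(g, h) \<mapsto> g\<inverse> h g\<close> near \<open>(\<one>, \<one>)\<close>.\<close>

definition conj_chart :: "'a \<times> 'a \<Rightarrow> 'a" where
  "conj_chart = chart C \<one> \<circ> (\<lambda>z. inv (fst z) \<otimes> snd z \<otimes> fst z) \<circ> chart_inv (prod_atlas C C) (\<one>, \<one>)"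

definition conj_dom :: "('a \<times> 'a) set" where
  "conj_dom = chart (prod_atlas C C) (\<one>, \<one>) `
     (chart_dom (prod_atlas C C) (\<one>, \<one>) \<inter> (\<lambda>z. inv (fst z) \<otimes> snd z \<otimes> fst z) -` chart_dom C \<one>)"

lemma one_in_chart_dom: "\<one> \<in> chart_dom C \<one>"
  by (rule chart_dom_self[OF charted])

lemma smooth_conj: "smooth_map (prod_atlas C C) C (\<lambda>z. inv (fst z) \<otimes> snd z \<otimes> fst z)"
  by (intro smooth_intros)

lemma open_conj_dom: "open conj_dom"
  unfolding conj_dom_def
  by (intro open_smooth_map_domain charted2 charted smooth_map_continuous[OF smooth_conj])

lemma conj_dom: "g \<in> chart_dom C \<one> \<Longrightarrow> (chart C \<one> g, chart C \<one> \<one>) \<in> conj_dom"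
  unfolding conj_dom_def using one_in_chart_dom by (intro image_eqI[of _ _ "(g, \<one>)"]) auto

lemma Ck_on_conj_chart: "Ck_on n conj_dom conj_chart"
  unfolding conj_dom_def conj_chart_def by (rule smooth_map_Ck[OF smooth_conj])

lemma Ad_has_velocity:
  assumes "has_velocity C \<sigma> \<eta> 0" "\<sigma> 0 = \<one>"
  shows "has_velocity C (\<lambda>h. inv g \<otimes> \<sigma> h \<otimes> g) (Ad G C g \<eta>) 0"
proof -
  have "smooth_map C C (\<lambda>h. inv g \<otimes> h \<otimes> g)" by (intro smooth_intros)
  from has_velocity_compose[OF charted charted this assms(1)] show ?thesis
    by (simp add: Ad_def assms(2))
qed

text \<open>Conjugation fixes the identity, so one target chart serves all g. \<open>Ad\<close>
  thereby becomes a partial derivative of a single map, in which g may be varied.\<close>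

lemma Ad_in_chart:
  assumes "g \<in> chart_dom C \<one>"
  shows "Ad G C g \<eta> = frechet_derivative conj_chart (at (chart C \<one> g, chart C \<one> \<one>)) (0, \<eta>)"
proof -
  obtain \<sigma> where \<sigma>: "\<sigma> 0 = \<one>" "has_velocity C \<sigma> \<eta> 0"
    using has_velocity_exists[OF charted] by blast
  have "chart_velocity C \<one> \<sigma> \<eta> 0" using \<sigma> has_velocity_iff[OF charted] by metis
  then have "chart_velocity (prod_atlas C C) (\<one>, \<one>) (\<lambda>h. (g, \<sigma> h)) (0, \<eta>) 0"
    using chart_velocity_const[OF assms] by (simp add: chart_velocity_Pair)
  from chart_velocity_compose[OF charted2 smooth_conj this, of \<one>]
  have "chart_velocity C \<one> (\<lambda>h. inv g \<otimes> \<sigma> h \<otimes> g)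
      (frechet_derivative conj_chart (at (chart C \<one> g, chart C \<one> \<one>)) (0, \<eta>)) 0"
    using \<sigma>(1) one_in_chart_dom by (simp add: conj_chart_def)
  moreover have "chart_velocity C \<one> (\<lambda>h. inv g \<otimes> \<sigma> h \<otimes> g) (Ad G C g \<eta>) 0"
    using Ad_has_velocity[OF \<sigma>(2,1), of g] \<sigma>(1) by (simp add: has_velocity_iff[OF charted])
  ultimately show ?thesis using chart_velocity_unique by blast
qed

text \<open>Kept as a function of both coordinates, so that its derivative in the first direction is
  the mixed second derivative of conjugation.\<close>

definition conj_deriv :: "'a \<Rightarrow> 'a \<times> 'a \<Rightarrow> 'a" where
  "conj_deriv \<eta> z = frechet_derivative conj_chart (at z) (0, \<eta>)"

lemma conj_deriv_has_derivative:
  "(conj_deriv \<eta> has_derivative frechet_derivative (conj_deriv \<eta>) (at (chart C \<one> \<one>, chart C \<one> \<one>)))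
     (at (chart C \<one> \<one>, chart C \<one> \<one>))"
proof (rule Ck_on_Suc_has_derivative)
  show "Ck_on (Suc 0) conj_dom (conj_deriv \<eta>)"
    using Ck_on_conj_chart[of "Suc (Suc 0)"] unfolding conj_deriv_def Ck_on.simps(2) by blast
qed (rule conj_dom[OF one_in_chart_dom])

text \<open>The chain rule along the subgroup of \<xi> exhibits the bracket as a mixed second
  derivative. Linearity in \<xi> is now that of a derivative, whereas the exponentials of \<xi>,
  \<xi>' and their sum have no direct relation.\<close>

lemma ad_in_chart:
  "ad G C \<xi> \<eta> = frechet_derivative (conj_deriv \<eta>) (at (chart C \<one> \<one>, chart C \<one> \<one>)) (\<xi>, 0)"
proof -
  let ?D = "frechet_derivative (conj_deriv \<eta>) (at (chart C \<one> \<one>, chart C \<one> \<one>))"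
  obtain c where c: "one_parameter_subgroup G C \<xi> c" using one_parameter_subgroup_exists by blast
  have c0: "c 0 = \<one>" by (rule one_parameter_subgroup_zero[OF c])
  have v: "has_velocity C c \<xi> 0" using c by (simp add: one_parameter_subgroup_def)
  have "((\<lambda>t. chart C \<one> (c t)) has_vector_derivative \<xi>) (at 0)"
    using v c0 by (simp add: has_velocity_def)
  then have "((\<lambda>t. (chart C \<one> (c t), chart C \<one> \<one>)) has_vector_derivative (\<xi>, 0)) (at 0)"
    unfolding has_vector_derivative_def scaleR_Pair scaleR_zero_right
    by (intro has_derivative_Pair has_derivative_const)
  then have d: "((\<lambda>t. conj_deriv \<eta> (chart C \<one> (c t), chart C \<one> \<one>)) has_vector_derivative ?D (\<xi>, 0)) (at 0)"
    using vector_derivative_diff_chain_within[of "\<lambda>t. (chart C \<one> (c t), chart C \<one> \<one>)" _ 0 UNIV "conj_deriv \<eta>" ?D]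
      conj_deriv_has_derivative[of \<eta>] c0 by (simp add: o_def has_derivative_at_withinI)
  let ?U = "c -` chart_dom C \<one>"
  have "continuous_on UNIV c"
    using c by (simp add: one_parameter_subgroup_def smooth_map_def)
  then have U: "open ?U" by (intro open_vimage open_chart_dom charted)
  have "((\<lambda>t. Ad G C (c t) \<eta>) has_vector_derivative ?D (\<xi>, 0)) (at 0)"
    by (rule has_vector_derivative_transform_within_open[OF d U])
       (use one_in_chart_dom c0 in \<open>auto simp: Ad_in_chart conj_deriv_def\<close>)
  then show ?thesis
    unfolding ad_def lie_exp_scaleR[OF c] by (rule vector_derivative_at)
qed

lemma ad_add_left: "ad G C (\<xi> + \<xi>') \<eta> = ad G C \<xi> \<eta> + ad G C \<xi>' \<eta>"
  using linear_add[OF has_derivative_linear[OF conj_deriv_has_derivative], of \<eta> "(\<xi>, 0)" "(\<xi>', 0)"]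
  by (simp add: ad_in_chart)

lemma conj_deriv_linear:
  assumes "z \<in> conj_dom"
  shows "conj_deriv (a *\<^sub>R \<eta> + \<eta>') z = a *\<^sub>R conj_deriv \<eta> z + conj_deriv \<eta>' z"
proof -
  have lin: "linear (frechet_derivative conj_chart (at z))"
    by (rule has_derivative_linear[OF Ck_on_Suc_has_derivative[OF Ck_on_conj_chart assms]])
  have "(0, a *\<^sub>R \<eta> + \<eta>') = a *\<^sub>R (0::'a, \<eta>) + (0, \<eta>')" by simp
  then show ?thesis
    unfolding conj_deriv_def by (simp only: linear_add[OF lin] linear_scale[OF lin])
qed

text \<open>Linearity of \<open>conj_deriv\<close> in \<eta> holds on an open set, hence survives
  one more differentiation.\<close>

lemma linear_ad: "linear (ad G C \<xi>)"
proof -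
  let ?z = "(chart C \<one> \<one>, chart C \<one> \<one>)"
  have *: "ad G C \<xi> (a *\<^sub>R \<eta> + \<eta>') = a *\<^sub>R ad G C \<xi> \<eta> + ad G C \<xi> \<eta>'" for a \<eta> \<eta>'
  proof -
    have "((\<lambda>z. a *\<^sub>R conj_deriv \<eta> z + conj_deriv \<eta>' z) has_derivative
        (\<lambda>v. a *\<^sub>R frechet_derivative (conj_deriv \<eta>) (at ?z) v + frechet_derivative (conj_deriv \<eta>') (at ?z) v)) (at ?z)"
      by (intro has_derivative_add has_derivative_scaleR_right conj_deriv_has_derivative)
    then have "(conj_deriv (a *\<^sub>R \<eta> + \<eta>') has_derivative
        (\<lambda>v. a *\<^sub>R frechet_derivative (conj_deriv \<eta>) (at ?z) v + frechet_derivative (conj_deriv \<eta>') (at ?z) v)) (at ?z)"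
      by (rule has_derivative_transform_within_open[OF _ open_conj_dom conj_dom[OF one_in_chart_dom]])
         (simp add: conj_deriv_linear)
    from frechet_derivative_at[OF this] show ?thesis
      by (simp add: ad_in_chart fun_eq_iff)
  qed
  show ?thesis
  proof (rule linearI)
    show "ad G C \<xi> (x + y) = ad G C \<xi> x + ad G C \<xi> y" for x y using *[of 1 x y] by simp
    then have "ad G C \<xi> 0 = 0" by (metis add_cancel_right_right add_0)
    then show "ad G C \<xi> (r *\<^sub>R x) = r *\<^sub>R ad G C \<xi> x" for r x using *[of r x 0] by simp
  qed
qed

lemma bounded_linear_ad: "bounded_linear (ad G C \<xi>)"
  by (rule finite_dim_bounded_linear[OF finite_dim linear_ad])

text \<open>A one-parameter subgroup commutes with itself.\<close>

lemma ad_self: "ad G C \<xi> \<xi> = 0"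
proof -
  obtain c where c: "one_parameter_subgroup G C \<xi> c" using one_parameter_subgroup_exists by blast
  have c0: "c 0 = \<one>" by (rule one_parameter_subgroup_zero[OF c])
  have v: "has_velocity C c \<xi> 0" and hom: "\<And>s t. c (s + t) = c s \<otimes> c t"
    using c by (auto simp: one_parameter_subgroup_def)
  have "Ad G C (c t) \<xi> = \<xi>" for t
  proof -
    have "inv (c t) \<otimes> c h \<otimes> c t = c h" for h
      using hom[of h t] hom[of t h] by (simp add: m_assoc add.commute inv_mult_cancel)
    then show ?thesis
      using Ad_has_velocity[OF v c0, of "c t"] v has_velocity_unique by simp
  qed
  then show ?thesis by (simp add: ad_def lie_exp_scaleR[OF c])
qed

text \<open>Polarisation of \<open>ad_self\<close> at \<xi> + \<eta>.\<close>

lemma ad_antisym: "ad G C \<xi> \<eta> = - ad G C \<eta> \<xi>"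
proof -
  have "ad G C \<xi> \<eta> + ad G C \<eta> \<xi> = ad G C (\<xi> + \<eta>) (\<xi> + \<eta>)"
    by (simp add: ad_add_left linear_add[OF linear_ad] ad_self[of \<xi>] ad_self[of \<eta>])
  then have "ad G C \<xi> \<eta> + ad G C \<eta> \<xi> = 0" by (simp only: ad_self)
  then show ?thesis by (simp add: eq_neg_iff_add_eq_0)
qed

lemma ad_zero_left: "ad G C 0 \<eta> = 0"
  using ad_antisym[of 0 \<eta>] linear_0[OF linear_ad] by simp

section \<open>Dual maps and right translations\<close>

lemma ad_dual_apply: "blinfun_apply (ad_dual G C \<xi> \<mu>) \<eta> = blinfun_apply \<mu> (ad G C \<xi> \<eta>)"
  unfolding ad_dual_def
  by (subst bounded_linear_Blinfun_apply)
     (auto intro: bounded_linear_compose[OF blinfun.bounded_linear_right bounded_linear_ad])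

lemma smooth_right_translation: "smooth_map C C (right_translation G g)"
  unfolding right_translation_def by (intro smooth_intros)

text \<open>By functoriality the inverse is the tangent map at g of translation by
  \<open>inv g\<close>.\<close>

lemma bij_TR: "bij (TR G C g)"
proof -
  let ?T = "tangent_map C C (right_translation G (inv g)) g"
  have "?T (TR G C g v) = v" for v
    using tangent_map_compose[OF charted charted charted smooth_right_translation[of g]
        smooth_right_translation[of "inv g"], of \<one> v] tangent_map_id[OF manifold, of \<one> v]
    by (simp add: TR_def right_translation_def m_assoc)
  moreover have "TR G C g (?T v) = v" for v
    using tangent_map_compose[OF charted charted charted smooth_right_translation[of "inv g"]
        smooth_right_translation[of g], of g v] tangent_map_id[OF manifold, of g v]
    by (simp add: TR_def right_translation_def m_assoc)
  ultimately show ?thesis by (metis bijI')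
qed

lemma bounded_linear_TR: "bounded_linear (TR G C g)"
  unfolding TR_def by (rule linear_tangent_map[OF charted charted smooth_right_translation])

lemma TR_dual_apply: "blinfun_apply (TR_dual G C g \<alpha>) \<eta> = blinfun_apply \<alpha> (TR G C g \<eta>)"
  unfolding TR_dual_def
  by (subst bounded_linear_Blinfun_apply)
     (auto intro: bounded_linear_compose[OF blinfun.bounded_linear_right bounded_linear_TR])

end

section \<open>Duality in finite dimension\<close>

lemma dual_expansion:
  fixes B :: "'a::real_normed_vector set"
  assumes "finite B" "\<And>b. bounded_linear (\<phi> b)" "\<And>x. x = (\<Sum>b\<in>B. \<phi> b x *\<^sub>R b)"
  shows "\<alpha> = (\<Sum>b\<in>B. blinfun_apply \<alpha> b *\<^sub>R Blinfun (\<phi> b))"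
proof (rule blinfun_eqI)
  fix x
  have "blinfun_apply \<alpha> x = (\<Sum>b\<in>B. \<phi> b x *\<^sub>R blinfun_apply \<alpha> b)"
    by (subst assms(3)[of x]) (simp add: blinfun.sum_right blinfun.scaleR_right)
  then show "blinfun_apply \<alpha> x = blinfun_apply (\<Sum>b\<in>B. blinfun_apply \<alpha> b *\<^sub>R Blinfun (\<phi> b)) x"
    by (simp add: blinfun.sum_left blinfun.scaleR_left bounded_linear_Blinfun_apply assms(2) mult.commute)
qed

lemma finite_dim_dual:
  assumes "finite_dim TYPE('a::real_normed_vector)"
  shows "finite_dim TYPE('a::real_normed_vector dual)"
proof -
  obtain B :: "'a set" and \<phi> where B: "finite B" "\<And>b. bounded_linear (\<phi> b)"
    "\<And>x. x = (\<Sum>b\<in>B. \<phi> b x *\<^sub>R b)"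
    using finite_dim_coordinates[OF assms] by blast
  let ?S = "(\<lambda>b. Blinfun (\<phi> b)) ` B"
  have "\<alpha> \<in> span ?S" for \<alpha> :: "'a dual"
    by (subst dual_expansion[OF B, of \<alpha>]) (intro span_sum span_scale span_base imageI)
  then have "span ?S = UNIV" by auto
  with B(1) show ?thesis unfolding finite_dim_def by blast
qed

lemma dual_separates:
  fixes \<eta> \<eta>' :: "'a::real_normed_vector"
  assumes "finite_dim TYPE('a)" "\<And>\<alpha> :: 'a dual. blinfun_apply \<alpha> \<eta> = blinfun_apply \<alpha> \<eta>'"
  shows "\<eta> = \<eta>'"
proof -
  obtain B :: "'a set" and \<phi> where B: "finite B" "\<And>b. bounded_linear (\<phi> b)"
    "\<And>x. x = (\<Sum>b\<in>B. \<phi> b x *\<^sub>R b)"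
    using finite_dim_coordinates[OF assms(1)] by blast
  have "\<phi> b \<eta> = \<phi> b \<eta>'" for b
    using assms(2)[of "Blinfun (\<phi> b)"] by (simp add: bounded_linear_Blinfun_apply B(2))
  then show ?thesis using B(3)[of \<eta>] B(3)[of \<eta>'] by simp
qed

lemma double_dual_evaluation:
  fixes L :: "'a::real_normed_vector dual \<Rightarrow> real"
  assumes "finite_dim TYPE('a)" "linear L"
  shows "L \<alpha> = blinfun_apply \<alpha> (THE \<eta>. \<forall>\<alpha>. L \<alpha> = blinfun_apply \<alpha> \<eta>)"
proof -
  obtain B :: "'a set" and \<phi> where B: "finite B" "\<And>b. bounded_linear (\<phi> b)"
    "\<And>x. x = (\<Sum>b\<in>B. \<phi> b x *\<^sub>R b)"
    using finite_dim_coordinates[OF assms(1)] by blast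
  \<comment> \<open>The coordinates of the representing vector are the values of L on the coordinate
    functionals.\<close>
  let ?\<eta> = "\<Sum>b\<in>B. L (Blinfun (\<phi> b)) *\<^sub>R b"
  have "L \<alpha> = blinfun_apply \<alpha> ?\<eta>" for \<alpha>
    using arg_cong[OF dual_expansion[OF B, of \<alpha>], of L]
    by (simp add: linear_sum[OF assms(2)] linear_scale[OF assms(2)] blinfun.sum_right
        blinfun.scaleR_right mult.commute)
  then have "\<exists>!\<eta>. \<forall>\<alpha>. L \<alpha> = blinfun_apply \<alpha> \<eta>"
    using dual_separates[OF assms(1)] by metis
  from theI'[OF this] show ?thesis by blast
qed

section \<open>The Hamiltonian vector field\<close>

context lie_group_atlas
begin

section \<open>Phase space, right invariant frame and symplectic form\<close>

lemma charted_phase_atlas: "charted (phase_atlas C)"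
  unfolding phase_atlas_def
  by (intro charted_prod_atlas charted charted_vector_atlas finite_dim finite_dim_dual)

lemma chart_inv_phase_atlas:
  assumes "x \<in> chart C g ` chart_dom C g"
  shows "chart_inv (phase_atlas C) (g, \<xi>, \<mu>, \<nu>) (x, y, u, w) = (chart_inv C g x, y, u, w)"
  unfolding phase_atlas_def
  using assms finite_dim finite_dim_dual[OF finite_dim]
  by (simp add: chart_inv_prod_atlas charted charted_prod_atlas charted_vector_atlas map_prod_surj)

text \<open>The frame is triangular: the first component determines \<eta> because \<open>TR\<close>
  is bijective, the second then gives \<zeta>, and these two fix \<alpha> and \<beta>.\<close>

lemma bij_inv_field: "bij (\<lambda>a. inv_field G C a p)"
proof -
  obtain g \<xi> \<mu> \<nu> where p: "p = (g, \<xi>, \<mu>, \<nu>)" by (metis prod_cases4)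
  have "a = b" if "inv_field G C a p = inv_field G C b p" for a b
    using that bij_is_inj[OF bij_TR, of g] by (cases a; cases b) (auto simp: p inj_eq)
  moreover have "\<exists>a. w = inv_field G C a p" for w
  proof -
    obtain w1 w2 w3 w4 where w: "w = (w1, w2, w3, w4)" by (metis prod_cases4)
    obtain \<eta> where \<eta>: "w1 = TR G C g \<eta>" using bij_is_surj[OF bij_TR, of g] by blast
    show ?thesis
      by (rule exI[of _ "(\<eta>, w2 - ad G C \<xi> \<eta>,
            w3 - ad_dual G C \<eta> \<mu> - ad_dual G C (w2 - ad G C \<xi> \<eta>) \<nu>, w4 - ad_dual G C \<eta> \<nu>)"])
         (simp add: p w \<eta>)
  qed
  ultimately show ?thesis by (metis bijI')
qed

text \<open>Every tangent vector is a frame vector in exactly one way, so the description in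
  \<open>Omega\<close> has exactly one solution, even among arbitrary functions of two
  vectors.\<close>

lemma Omega_inv_field:
  "Omega G C p (inv_field G C a p) (inv_field G C b p) = Omega_inv G C p a b"
proof -
  let ?I = "inv_into UNIV (\<lambda>a. inv_field G C a p)"
  let ?P = "\<lambda>\<omega>. \<forall>a b. \<omega> (inv_field G C a p) (inv_field G C b p) = Omega_inv G C p a b"
  have I: "?I (inv_field G C a p) = a" "inv_field G C (?I v) p = v" for a v
    using inv_f_f[OF bij_is_inj[OF bij_inv_field]] surj_f_inv_f[OF bij_is_surj[OF bij_inv_field]]
    by blast+
  have ex: "?P (\<lambda>v w. Omega_inv G C p (?I v) (?I w))" by (simp add: I)
  have unique: "\<And>\<omega> \<omega>'. ?P \<omega> \<Longrightarrow> ?P \<omega>' \<Longrightarrow> \<omega> = \<omega>'"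
  proof (intro ext)
    fix \<omega> \<omega>' v w assume "?P \<omega>" "?P \<omega>'"
    then show "\<omega> v w = \<omega>' v w" using I(2)[of v] I(2)[of w] by metis
  qed
  have "\<exists>!\<omega>. ?P \<omega>" by (rule ex1I[of ?P, OF ex unique[OF _ ex]])
  from theI'[OF this] show ?thesis unfolding Omega_def by blast
qed

text \<open>Covector tests isolate \<eta> and \<zeta>. Once these agree, the bracket terms on both
  sides cancel, and vector tests isolate \<beta> and \<alpha>. Comparing two vectors is the form
  that uniqueness of \<open>hamiltonian_field\<close> calls for.\<close>

lemma Omega_inv_nondegenerate:
  assumes "\<And>b. Omega_inv G C p a b = Omega_inv G C p a' b"
  shows "a = a'"
proof -
  obtain g \<xi> \<mu> \<nu> where p: "p = (g, \<xi>, \<mu>, \<nu>)" by (metis prod_cases4)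
  obtain \<eta> \<zeta> \<alpha> \<beta> where a: "a = (\<eta>, \<zeta>, \<alpha>, \<beta>)" by (metis prod_cases4)
  obtain \<eta>' \<zeta>' \<alpha>' \<beta>' where a': "a' = (\<eta>', \<zeta>', \<alpha>', \<beta>')" by (metis prod_cases4)
  note simps = p a a' linear_0[OF linear_ad] ad_zero_left blinfun.zero_left
  have \<eta>: "\<eta> = \<eta>'"
    by (rule dual_separates[OF finite_dim])
       (use assms[of "(0, 0, \<kappa>, 0)" for \<kappa>] in \<open>simp add: simps\<close>)
  have \<zeta>: "\<zeta> = \<zeta>'"
    by (rule dual_separates[OF finite_dim])
       (use assms[of "(0, 0, 0, \<kappa>)" for \<kappa>] in \<open>simp add: simps\<close>)
  have "\<beta> = \<beta>'"
    by (rule blinfun_eqI) (use assms[of "(0, v, 0, 0)" for v] in \<open>simp add: simps \<eta> \<zeta>\<close>)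
  moreover have "\<alpha> = \<alpha>'"
    by (rule blinfun_eqI) (use assms[of "(v, 0, 0, 0)" for v] in \<open>simp add: simps \<eta> \<zeta>\<close>)
  ultimately show ?thesis using \<eta> \<zeta> a a' by simp
qed

section \<open>Differential and Hamiltonian field in the frame\<close>

lemma differential_eq:
  assumes "smooth_map (phase_atlas C) vector_atlas H"
  shows "differential C H p (v, y, u, w) = blinfun_apply (delta_g C H p) v
    + blinfun_apply (delta_xi H p) y + blinfun_apply u (delta_mu H p) + blinfun_apply w (delta_nu H p)"
proof -
  obtain g \<xi> \<mu> \<nu> where p: "p = (g, \<xi>, \<mu>, \<nu>)" by (metis prod_cases4)
  define x0 where "x0 = chart C g g"
  define D where "D = differential C H p"
  let ?H = "H \<circ> chart_inv (phase_atlas C) p"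
  have chart_p: "chart (phase_atlas C) p p = (x0, \<xi>, \<mu>, \<nu>)"
    by (simp add: p phase_atlas_def x0_def)
  have D: "(?H has_derivative D) (at (x0, \<xi>, \<mu>, \<nu>))"
    using smooth_map_has_derivative[OF assms chart_dom_self[OF charted_phase_atlas], of p "H p"]
    by (simp add: D_def differential_def tangent_map_def chart_p)
  have bl: "bounded_linear D" using D by (rule has_derivative_bounded_linear)
  have g: "g \<in> chart_dom C g" by (rule chart_dom_self[OF charted])
  have H: "?H (x, y, u, w) = H (chart_inv C g x, y, u, w)" if "x \<in> chart C g ` chart_dom C g" for x y u w
    using chart_inv_phase_atlas[OF that] by (simp add: p)
  \<comment> \<open>With x fixed at x0 the slices in the vector variables agree with H everywhere;
    the slice in x agrees with it only on the chart image, hence needs a local argument.\<close>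
  have H0: "?H (x0, y, u, w) = H (g, y, u, w)" for y u w
    using H[of x0 y u w] g chart_inv_chart[OF charted g] by (simp add: x0_def)
  have "((\<lambda>x. (x, \<xi>, \<mu>, \<nu>)) has_derivative (\<lambda>v. (v, 0, 0, 0))) (at x0)"
    by (intro has_derivative_Pair has_derivative_ident has_derivative_const)
  from has_derivative_compose[OF this D]
  have "((\<lambda>x. ?H (x, \<xi>, \<mu>, \<nu>)) has_derivative (\<lambda>v. D (v, 0, 0, 0))) (at x0)" .
  then have "((\<lambda>x. H (chart_inv C g x, \<xi>, \<mu>, \<nu>)) has_derivative (\<lambda>v. D (v, 0, 0, 0))) (at x0)"
    by (rule has_derivative_transform_within_open[OF _ open_chart_range[OF charted, of g]])
       (use H g in \<open>auto simp: x0_def\<close>)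
  note dg = this
  have "((\<lambda>y. (x0, y, \<mu>, \<nu>)) has_derivative (\<lambda>v. (0, v, 0, 0))) (at \<xi>)"
    by (intro has_derivative_Pair has_derivative_ident has_derivative_const)
  from has_derivative_compose[OF this D]
  have d\<xi>: "((\<lambda>y. H (g, y, \<mu>, \<nu>)) has_derivative (\<lambda>v. D (0, v, 0, 0))) (at \<xi>)"
    unfolding H0 .
  have "((\<lambda>u. (x0, \<xi>, u, \<nu>)) has_derivative (\<lambda>v. (0, 0, v, 0))) (at \<mu>)"
    by (intro has_derivative_Pair has_derivative_ident has_derivative_const)
  from has_derivative_compose[OF this D]
  have d\<mu>: "((\<lambda>u. H (g, \<xi>, u, \<nu>)) has_derivative (\<lambda>v. D (0, 0, v, 0))) (at \<mu>)"
    unfolding H0 .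
  have "((\<lambda>w. (x0, \<xi>, \<mu>, w)) has_derivative (\<lambda>v. (0, 0, 0, v))) (at \<nu>)"
    by (intro has_derivative_Pair has_derivative_ident has_derivative_const)
  from has_derivative_compose[OF this D]
  have d\<nu>: "((\<lambda>w. H (g, \<xi>, \<mu>, w)) has_derivative (\<lambda>v. D (0, 0, 0, v))) (at \<nu>)"
    unfolding H0 .
  have "blinfun_apply (delta_g C H p) v = D (v, 0, 0, 0)"
    using has_derivative_bounded_linear[OF dg]
    by (simp add: p tangent_map_def o_def x0_def[symmetric] frechet_derivative_at[OF dg, symmetric]
        bounded_linear_Blinfun_apply)
  moreover have "blinfun_apply (delta_xi H p) y = D (0, y, 0, 0)"
    using has_derivative_bounded_linear[OF d\<xi>]
    by (simp add: p frechet_derivative_at[OF d\<xi>, symmetric] bounded_linear_Blinfun_apply)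
  moreover have "blinfun_apply u (delta_mu H p) = D (0, 0, u, 0)"
    using double_dual_evaluation[OF finite_dim has_derivative_linear[OF d\<mu>], of u]
    by (simp add: p frechet_derivative_at[OF d\<mu>, symmetric])
  moreover have "blinfun_apply w (delta_nu H p) = D (0, 0, 0, w)"
    using double_dual_evaluation[OF finite_dim has_derivative_linear[OF d\<nu>], of w]
    by (simp add: p frechet_derivative_at[OF d\<nu>, symmetric])
  moreover have "D (v, y, u, w) = D (v, 0, 0, 0) + D (0, y, 0, 0) + D (0, 0, u, 0) + D (0, 0, 0, w)"
    by (simp add: linear_add[OF bounded_linear.linear[OF bl], symmetric])
  ultimately show ?thesis by (simp add: D_def)
qed

text \<open>The first two components of a frame vector contain \<open>TR\<close> of \<eta> and
  [\<xi>, \<eta>]. Paired with the derivatives in g and \<xi> and collected at \<eta>, they become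
  the \<open>TR_dual\<close> and \<open>ad_dual\<close> terms of the third component.\<close>

lemma hamiltonian_field_eq:
  fixes H :: "('g, 'a) phase \<Rightarrow> real"
  assumes "smooth_map (phase_atlas C) vector_atlas H" "p = (g, \<xi>, \<mu>, \<nu>)"
  shows "hamiltonian_field G C H p = inv_field G C
    (delta_mu H p, delta_nu H p,
     - TR_dual G C g (delta_g C H p) - ad_dual G C \<xi> (delta_xi H p), - delta_xi H p) p"
    (is "_ = inv_field G C ?a p")
proof -
  have eq: "Omega_inv G C p ?a b = - differential C H p (inv_field G C b p)" for b
  proof -
    obtain \<eta> \<zeta> \<alpha> \<beta> where b: "b = (\<eta>, \<zeta>, \<alpha>, \<beta>)" by (metis prod_cases4)
    let ?m = "delta_mu H p" and ?n = "delta_nu H p"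
    \<comment> \<open>With m the derivative of H in \<mu>, the differential contributes [\<eta>, m]
      paired with \<mu> and [\<zeta>, m] paired with \<nu>, where \<open>Omega_inv\<close> has
      [m, \<eta>] and [m, \<zeta>]. Antisymmetry absorbs the minus sign before the
      differential.\<close>
    have anti: "ad G C \<eta> ?m = - ad G C ?m \<eta>" "ad G C \<zeta> ?n = - ad G C ?n \<zeta>"
      "ad G C \<zeta> ?m = - ad G C ?m \<zeta>"
      by (rule ad_antisym)+
    define m n where "m = ?m" and "n = ?n"
    show ?thesis
      using anti unfolding b m_def[symmetric] n_def[symmetric]
      by (simp add: assms(2) differential_eq[OF assms(1)[unfolded assms(2)]] m_def n_def
          blinfun.add_left blinfun.diff_left blinfun.minus_left blinfun.add_right blinfun.diff_right
          blinfun.minus_right ad_dual_apply TR_dual_apply)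
  qed
  show ?thesis
    unfolding hamiltonian_field_def
  proof (rule the_equality)
    show "\<forall>w. Omega G C p (inv_field G C ?a p) w = - differential C H p w"
    proof
      fix w
      obtain b where "w = inv_field G C b p"
        using bij_is_surj[OF bij_inv_field, of p] by blast
      then show "Omega G C p (inv_field G C ?a p) w = - differential C H p w"
        using eq Omega_inv_field by simp
    qed
    fix v assume v: "\<forall>w. Omega G C p v w = - differential C H p w"
    obtain a where a: "v = inv_field G C a p"
      using bij_is_surj[OF bij_inv_field, of p] by blast
    have "Omega_inv G C p a b = Omega_inv G C p ?a b" for b
      using spec[OF v, of "inv_field G C b p"] eq[of b] Omega_inv_field[of p a b] a by metis
    then show "v = inv_field G C ?a p" using Omega_inv_nondegenerate a by blast
  qed
qed

end

theorem mainTheorem4: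
  fixes G :: "'g::{t2_space, second_countable_topology} monoid"
    and C :: "('g, 'a::banach) atlas"
    and H :: "('g, 'a) phase \<Rightarrow> real"
    and I :: "real set"
    and g :: "real \<Rightarrow> 'g" and \<xi> :: "real \<Rightarrow> 'a" and \<mu> \<nu> :: "real \<Rightarrow> 'a dual"
  assumes "lie_group G C"
    and "smooth_map (phase_atlas C) vector_atlas H"
    and "open I" and "is_interval I"
  shows "let z = (\<lambda>t. (g t, \<xi> t, \<mu> t, \<nu> t)) in
    integral_curve (phase_atlas C) (hamiltonian_field G C H) I z \<longleftrightarrow>
    (\<forall>t\<in>I.
       has_velocity C g (TR G C (g t) (delta_mu H (z t))) t \<and>
       (\<xi> has_vector_derivative
          delta_nu H (z t) + ad G C (\<xi> t) (delta_mu H (z t))) (at t) \<and>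
       (\<mu> has_vector_derivative
          - TR_dual G C (g t) (delta_g C H (z t))
          - ad_dual G C (\<xi> t) (delta_xi H (z t))
          + ad_dual G C (delta_mu H (z t)) (\<mu> t)
          + ad_dual G C (delta_nu H (z t)) (\<nu> t)) (at t) \<and>
       (\<nu> has_vector_derivative
          - delta_xi H (z t) + ad_dual G C (delta_mu H (z t)) (\<nu> t)) (at t))"
proof -
  interpret lie_group_atlas G C by unfold_locales (rule assms(1))
  have V: "charted (vector_atlas :: ('a, 'a) atlas)" "charted (vector_atlas :: ('a dual, 'a dual) atlas)"
    using charted_vector_atlas finite_dim finite_dim_dual by blast+
  have "has_velocity (phase_atlas C) (\<lambda>t. (g t, \<xi> t, \<mu> t, \<nu> t)) (x, y, u, w) t \<longleftrightarrow>
      has_velocity C g x t \<and> (\<xi> has_vector_derivative y) (at t) \<and>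
      (\<mu> has_vector_derivative u) (at t) \<and> (\<nu> has_vector_derivative w) (at t)" for x y u w t
    unfolding phase_atlas_def
    by (simp add: has_velocity_Pair charted charted_prod_atlas V has_velocity_vector_atlas)
  \<comment> \<open>The other bracket terms of the equations, the one in the second and those acting
    on \<mu> and \<nu>, are what \<open>inv_field\<close> adds to the frame components.\<close>
  then show ?thesis
    unfolding Let_def integral_curve_def hamiltonian_field_eq[OF assms(2) refl] inv_field.simps
    by blast
qed

end
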